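(* Let $B$ be a discrete abelian group, $\alpha\in\mathrm{Aut}(B)$, and $G=B\rtimes_\alpha\mathbb{Z}$. Let $R$ be the right regular representation of $G$ on $l^2(G)$, $(R(g_1)F)(g_2)=F(g_2g_1)$ for $g_1,g_2\in G$, $F\in l^2(G)$. For $\chi\in K:=\hat B$ set $U_\chi:=\mathrm{Ind}_B^G(\chi)$, and let $\mu$ be the normalized Haar measure of the compact group $K$. Then there is the orthogonal direct integral decomposition (up to unitary equivalence) $$R=\int_K^{\oplus}U_\chi\,d\mu(\chi).$$
   Context: $K=\hat B$ is the compact Pontryagin dual of $B$. The discrete group $G=B\rtimes_\alpha\mathbb{Z}$ is $\mathbb{Z}\times B$ with product $(j,b)(k,c)=(j+k,\alpha^j(c)+b)$. For $\chi\in K$, $\mathrm{Ind}_B^G(\chi)$ acts on the Hilbert space $\mathcal{H}(\chi)$ of functions $F:G\to\mathbb{C}$ with $F(j,b)=\chi(b)F(j,0)$ and $\|F\|_\chi^2=\sum_{j\in\mathbb{Z}}|F(j,0)|^2<\infty$, by $(\mathrm{Ind}_B^G(\chi)(g_1)F)(g_2)=F(g_2g_1)$. The direct integral Hilbert space $\int_K^\oplus\mathcal{H}(\chi)\,d\mu(\chi)$ consists of (classes of) measurable fields $\varphi:K\times G\to\mathbb{C}$ with $\varphi(\chi,\cdot)\in\mathcal{H}(\chi)$ and $\int_K\|\varphi(\chi,\cdot)\|_{\mathcal{H}(\chi)}^2\,d\mu(\chi)<\infty$; identifying each $\mathcal{H}(\chi)$ with $l^2(\mathbb{Z})$ via $F\mapsto(F(j,0))_{j\in\mathbb{Z}}$,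 it is $L^2(K,\mu;l^2(\mathbb{Z}))$. The direct integral representation acts fiberwise by $U_\chi$. *)

theory Defs
  imports "HOL-Analysis.Analysis" "HOL-Algebra.Group"
begin

section \<open>Inner product spaces and unitary representations\<close>

text \<open>Complex inner product spaces are carried by sets, because the fibre spaces below depend on a
  parameter. The inner product is linear in the first argument.\<close>

record 'v cinner_space =
  vecs :: "'v set"
  vadd :: "'v \<Rightarrow> 'v \<Rightarrow> 'v"
  vscale :: "complex \<Rightarrow> 'v \<Rightarrow> 'v"
  vinner :: "'v \<Rightarrow> 'v \<Rightarrow> complex"

definition unitary_map :: "'v cinner_space \<Rightarrow> 'w cinner_space \<Rightarrow> ('v \<Rightarrow> 'w) \<Rightarrow> bool" where
  "unitary_map V W T \<longleftrightarrow>
     bij_betw T (vecs V) (vecs W) \<and>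
     (\<forall>u\<in>vecs V. \<forall>v\<in>vecs V. T (vadd V u v) = vadd W (T u) (T v)) \<and>
     (\<forall>c. \<forall>v\<in>vecs V. T (vscale V c v) = vscale W c (T v)) \<and>
     (\<forall>u\<in>vecs V. \<forall>v\<in>vecs V. vinner W (T u) (T v) = vinner V u v)"

text \<open>All groups represented here are discrete, so no continuity condition is imposed.\<close>

definition unitary_rep ::
  "('g, 'm) monoid_scheme \<Rightarrow> 'v cinner_space \<Rightarrow> ('g \<Rightarrow> 'v \<Rightarrow> 'v) \<Rightarrow> bool" where
  "unitary_rep G V \<pi> \<longleftrightarrow>
     group G \<and>
     (\<forall>g\<in>carrier G. unitary_map V V (\<pi> g)) \<and>
     (\<forall>g\<in>carrier G. \<forall>h\<in>carrier G. \<forall>v\<in>vecs V. \<pi> (g \<otimes>\<^bsub>G\<^esub> h) v = \<pi> g (\<pi> h v))"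

definition unitarily_equivalent ::
  "('g, 'm) monoid_scheme \<Rightarrow> 'v cinner_space \<Rightarrow> ('g \<Rightarrow> 'v \<Rightarrow> 'v)
     \<Rightarrow> 'w cinner_space \<Rightarrow> ('g \<Rightarrow> 'w \<Rightarrow> 'w) \<Rightarrow> bool" where
  "unitarily_equivalent G V \<pi> W \<rho> \<longleftrightarrow>
     unitary_rep G V \<pi> \<and> unitary_rep G W \<rho> \<and>
     (\<exists>T. unitary_map V W T \<and> (\<forall>g\<in>carrier G. \<forall>v\<in>vecs V. T (\<pi> g v) = \<rho> g (T v)))"


section \<open>Direct integrals of spaces of functions\<close>

text \<open>Every fibre \<open>H x\<close> consists of functions on one index type \<open>'g\<close>. Measurability of a field is
  required at each index separately. For an uncountable discrete \<open>'g\<close> this is weaker than joint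
  measurability for the product with the power set of \<open>'g\<close>; it is the condition that amounts to
  measurability as a map into \<open>l\<^sup>2(\<int>)\<close> for the fibres \<open>ind_space \<xi>\<close> below.\<close>

definition l2_fields ::
  "'x measure \<Rightarrow> ('x \<Rightarrow> ('g \<Rightarrow> complex) cinner_space) \<Rightarrow> ('x \<Rightarrow> 'g \<Rightarrow> complex) set" where
  "l2_fields \<mu> H =
     {\<phi>. (\<forall>x\<in>space \<mu>. \<phi> x \<in> vecs (H x)) \<and>
         (\<forall>g. (\<lambda>x. \<phi> x g) \<in> borel_measurable \<mu>) \<and>
         integrable \<mu> (\<lambda>x. Re (vinner (H x) (\<phi> x) (\<phi> x)))}"

definition field_eq ::
  "'x measure \<Rightarrow> ('x \<Rightarrow> ('g \<Rightarrow> complex) cinner_space)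
     \<Rightarrow> (('x \<Rightarrow> 'g \<Rightarrow> complex) \<times> ('x \<Rightarrow> 'g \<Rightarrow> complex)) set" where
  "field_eq \<mu> H =
     {(\<phi>, \<psi>). \<phi> \<in> l2_fields \<mu> H \<and> \<psi> \<in> l2_fields \<mu> H \<and> (AE x in \<mu>. \<phi> x = \<psi> x)}"

text \<open>Vectors are classes modulo almost everywhere equality; each operation is defined without
  choosing representatives, as the set of all fields almost everywhere equal to the fibrewise
  result.\<close>

definition direct_integral ::
  "'x measure \<Rightarrow> ('x \<Rightarrow> ('g \<Rightarrow> complex) cinner_space)
     \<Rightarrow> ('x \<Rightarrow> 'g \<Rightarrow> complex) set cinner_space" where
  "direct_integral \<mu> H =
     \<lparr> vecs = l2_fields \<mu> H // field_eq \<mu> H,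
       vadd = (\<lambda>C D. {\<rho> \<in> l2_fields \<mu> H.
                 \<exists>\<phi>\<in>C. \<exists>\<psi>\<in>D. AE x in \<mu>. \<rho> x = vadd (H x) (\<phi> x) (\<psi> x)}),
       vscale = (\<lambda>c C. {\<rho> \<in> l2_fields \<mu> H. \<exists>\<phi>\<in>C. AE x in \<mu>. \<rho> x = vscale (H x) c (\<phi> x)}),
       vinner = (\<lambda>C D. THE z. \<forall>\<phi>\<in>C. \<forall>\<psi>\<in>D. z = (LINT x|\<mu>. vinner (H x) (\<phi> x) (\<psi> x))) \<rparr>"

definition direct_integral_rep ::
  "'x measure \<Rightarrow> ('x \<Rightarrow> ('g \<Rightarrow> complex) cinner_space)
     \<Rightarrow> ('x \<Rightarrow> 'h \<Rightarrow> ('g \<Rightarrow> complex) \<Rightarrow> ('g \<Rightarrow> complex))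
     \<Rightarrow> 'h \<Rightarrow> ('x \<Rightarrow> 'g \<Rightarrow> complex) set \<Rightarrow> ('x \<Rightarrow> 'g \<Rightarrow> complex) set" where
  "direct_integral_rep \<mu> H U h C =
     {\<psi> \<in> l2_fields \<mu> H. \<exists>\<phi>\<in>C. AE x in \<mu>. \<psi> x = U x h (\<phi> x)}"


section \<open>The semidirect product and the right regular representation\<close>

definition aut_pow :: "('b \<Rightarrow> 'b) \<Rightarrow> int \<Rightarrow> 'b \<Rightarrow> 'b" where
  "aut_pow \<alpha> j = (if 0 \<le> j then \<alpha> ^^ nat j else (inv_into UNIV \<alpha>) ^^ nat (- j))"

definition semidirect :: "('b::ab_group_add \<Rightarrow> 'b) \<Rightarrow> (int \<times> 'b) monoid" where
  "semidirect \<alpha> =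
     \<lparr> carrier = UNIV,
       mult = (\<lambda>(j, b) (k, c). (j + k, aut_pow \<alpha> j c + b)),
       one = (0, 0) \<rparr>"

definition l2_space :: "('g \<Rightarrow> complex) cinner_space" where
  "l2_space =
     \<lparr> vecs = {F. (\<lambda>g. (cmod (F g))\<^sup>2) summable_on UNIV},
       vadd = (\<lambda>F F' g. F g + F' g),
       vscale = (\<lambda>c F g. c * F g),
       vinner = (\<lambda>F F'. \<Sum>\<^sub>\<infinity>g. F g * cnj (F' g)) \<rparr>"

definition right_regular ::
  "('g, 'm) monoid_scheme \<Rightarrow> 'g \<Rightarrow> ('g \<Rightarrow> complex) \<Rightarrow> ('g \<Rightarrow> complex)" where
  "right_regular G g\<^sub>1 F = (\<lambda>g\<^sub>2. F (g\<^sub>2 \<otimes>\<^bsub>G\<^esub> g\<^sub>1))"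


section \<open>The dual group and its Haar measure\<close>

definition dual_group :: "('b::ab_group_add \<Rightarrow> complex) set" where
  "dual_group = {\<xi>. (\<forall>b. cmod (\<xi> b) = 1) \<and> (\<forall>a b. \<xi> (a + b) = \<xi> a * \<xi> b)}"

text \<open>The topology of the dual is that of pointwise convergence, the subspace topology from
  \<open>'b \<Rightarrow> complex\<close>. Regularity has to be demanded: for uncountable \<open>'b\<close> the dual
  is not metrizable.\<close>

definition normalized_haar :: "('b::ab_group_add \<Rightarrow> complex) measure \<Rightarrow> bool" where
  "normalized_haar \<mu> \<longleftrightarrow>
     sets \<mu> = sets (restrict_space borel dual_group) \<and>
     emeasure \<mu> dual_group = 1 \<and>
     (\<forall>\<psi>\<in>dual_group. \<forall>A\<in>sets \<mu>. emeasure \<mu> ((\<lambda>\<xi> b. \<psi> b * \<xi> b) ` A) = emeasure \<mu> A) \<and>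
     (\<forall>A\<in>sets \<mu>. emeasure \<mu> A = (INF V\<in>{V. open V \<and> A \<subseteq> V}. emeasure \<mu> (V \<inter> dual_group))) \<and>
     (\<forall>A\<in>sets \<mu>. emeasure \<mu> A = (SUP C\<in>{C. compact C \<and> C \<subseteq> A}. emeasure \<mu> C))"


section \<open>Induced representations\<close>

definition ind_space :: "('b::ab_group_add \<Rightarrow> complex) \<Rightarrow> (int \<times> 'b \<Rightarrow> complex) cinner_space" where
  "ind_space \<xi> =
     \<lparr> vecs = {F. (\<forall>j b. F (j, b) = \<xi> b * F (j, 0)) \<and>
                  (\<lambda>j. (cmod (F (j, 0)))\<^sup>2) summable_on UNIV},
       vadd = (\<lambda>F F' g. F g + F' g),
       vscale = (\<lambda>c F g. c * F g),
       vinner = (\<lambda>F F'. \<Sum>\<^sub>\<infinity>j. F (j, 0) * cnj (F' (j, 0))) \<rparr>"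

text \<open>The action is right translation for every \<open>\<xi>\<close>; the character enters only through the
  space \<open>ind_space \<xi>\<close> acted on.\<close>

definition ind_rep ::
  "('b::ab_group_add \<Rightarrow> 'b) \<Rightarrow> ('b \<Rightarrow> complex)
     \<Rightarrow> int \<times> 'b \<Rightarrow> (int \<times> 'b \<Rightarrow> complex) \<Rightarrow> (int \<times> 'b \<Rightarrow> complex)" where
  "ind_rep \<alpha> \<xi> g\<^sub>1 F = (\<lambda>g\<^sub>2. F (g\<^sub>2 \<otimes>\<^bsub>semidirect \<alpha>\<^esub> g\<^sub>1))"

end

theory Submission
  imports Defs
begin

text \<open>
  Write \<open>K\<close> for the dual group. On the coset of \<open>B\<close> in \<open>G\<close> indexed by \<open>j\<close>, a vector of the regular
  representation is a function \<open>b \<mapsto> F (j, b)\<close> in \<open>l\<^sup>2(B)\<close>, and the Plancherel theorem of the discrete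
  abelian group \<open>B\<close> turns it into an element \<open>f\<^sub>j\<close> of \<open>L\<^sup>2(K)\<close> with \<open>F (j, b) = \<integral> f\<^sub>j(\<xi>) \<xi>(b) d\<mu>\<close>.
  For fixed \<open>\<xi>\<close>, the numbers \<open>f\<^sub>j(\<xi>)\<close> are the values at \<open>(j, 0)\<close> of a vector \<open>\<phi> \<xi>\<close> of the fibre
  over \<open>\<xi>\<close>, whose value at \<open>(j, b)\<close> is \<open>\<xi>(b) f\<^sub>j(\<xi>)\<close>. The relation between \<open>F\<close> and \<open>\<phi>\<close> is
  therefore simply \<open>F g = \<integral> \<phi> \<xi> g d\<mu>\<close>. Both representations are right translations in the argument
  \<open>g\<close>, so the intertwining property is immediate; what remains is that \<open>\<phi> \<mapsto> F\<close>
  is unitary from classes of fields onto \<open>l\<^sup>2(G)\<close>.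

  Unitarity rests on the fact that the characters \<open>\<xi> \<mapsto> \<xi>(b)\<close> form an orthonormal basis of
  \<open>L\<^sup>2(K)\<close>. Orthogonality follows from invariance of the measure once every \<open>b \<noteq> 0\<close> is known to have
  a value other than \<open>1\<close> under some character (\<open>dual_group_separates_0\<close>, by Zorn's lemma and divisibility of the circle).
  Completeness combines compactness of \<open>K\<close>, regularity of the measure and the separation argument
  behind the Stone--Weierstrass theorem (\<open>multiplier_approximates_indicator\<close>): a function orthogonal
  to all characters has integral zero over every measurable set. Given a basis, \<open>Parseval\<close> makes the
  transform isometric and \<open>Riesz_Fischer\<close>, applied for each \<open>j\<close>, makes it surjective
  (\<open>transform_isometric\<close>, \<open>transform_surj\<close>). The representation property on the direct integral is
  transported along the resulting unitary map.
\<close>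

section \<open>Square integrable functions\<close>

lemma cmod_add_square_le: "(cmod (u + v))\<^sup>2 \<le> 2 * (cmod u)\<^sup>2 + 2 * (cmod v)\<^sup>2"
proof -
  have "(cmod (u + v))\<^sup>2 \<le> (cmod u + cmod v)\<^sup>2"
    by (simp add: norm_triangle_ineq power_mono)
  also have "\<dots> \<le> 2 * (cmod u)\<^sup>2 + 2 * (cmod v)\<^sup>2"
    using zero_le_power2[of "cmod u - cmod v"] by (simp add: power2_eq_square algebra_simps)
  finally show ?thesis .
qed

lemma cmod_mult_le_weighted_squares:
  assumes "t > 0"
  shows "cmod (u * v) \<le> (t * (cmod u)\<^sup>2 + (cmod v)\<^sup>2 / t) / 2"
proof -
  have "0 \<le> (t * cmod u - cmod v)\<^sup>2" by simp
  then have "2 * t * (cmod u * cmod v) \<le> t\<^sup>2 * (cmod u)\<^sup>2 + (cmod v)\<^sup>2"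
    by (simp add: power2_eq_square algebra_simps)
  then show ?thesis
    using assms by (simp add: norm_mult field_simps power2_eq_square)
qed

text \<open>The polarization identity recovers an inner product from the values \<open>N c = \<parallel>u + c v\<parallel>\<^sup>2\<close>. Only
  norms have to be compared below; as \<open>polar\<close> commutes with sums and integrals, equality of inner
  products follows.\<close>

definition polar :: "(complex \<Rightarrow> real) \<Rightarrow> complex" where
  "polar N = (of_real (N 1) + (-1) * of_real (N (-1)) + \<i> * of_real (N \<i>) + (-\<i>) * of_real (N (-\<i>))) / 4"

lemma polarization_cnj: "u * cnj v = polar (\<lambda>c. (cmod (u + c * v))\<^sup>2)"
  unfolding polar_def cmod_power2 complex_eq_iff
  by (simp add: power2_eq_square field_simps)

lemma has_sum_polar:
  assumes "\<And>c. ((\<lambda>i. N i c) has_sum S c) A"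
  shows "((\<lambda>i. polar (N i)) has_sum polar S) A"
  unfolding polar_def divide_inverse
  by (intro has_sum_cmult_left has_sum_add has_sum_cmult_right has_sum_of_real assms)

lemma integral_polar:
  assumes "\<And>c. integrable M (\<lambda>x. N x c)"
  shows "(LINT x|M. polar (N x)) = polar (\<lambda>c. LINT x|M. N x c)"
  using assms by (simp add: polar_def)

definition square_integrable :: "'a measure \<Rightarrow> ('a \<Rightarrow> complex) \<Rightarrow> bool" where
  "square_integrable M f \<longleftrightarrow>
     f \<in> borel_measurable M \<and> integrable M (\<lambda>x. (cmod (f x))\<^sup>2)"

lemma square_integrableD:
  assumes "square_integrable M f"
  shows "f \<in> borel_measurable M" "integrable M (\<lambda>x. (cmod (f x))\<^sup>2)"
  using assms by (auto simp: square_integrable_def)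

lemma square_integrable_add [intro]:
  assumes "square_integrable M f" "square_integrable M g"
  shows "square_integrable M (\<lambda>x. f x + g x)"
proof -
  have [measurable]: "f \<in> borel_measurable M" "g \<in> borel_measurable M"
    using assms by (auto simp: square_integrable_def)
  have "integrable M (\<lambda>x. (cmod (f x + g x))\<^sup>2)"
    by (rule Bochner_Integration.integrable_bound
          [where f = "\<lambda>x. 2 * (cmod (f x))\<^sup>2 + 2 * (cmod (g x))\<^sup>2"])
       (use assms cmod_add_square_le in \<open>auto simp: square_integrable_def\<close>)
  then show ?thesis by (simp add: square_integrable_def)
qed

lemma square_integrable_cmult [intro]:
  assumes "square_integrable M f"
  shows "square_integrable M (\<lambda>x. c * f x)"
  using assms by (auto simp: square_integrable_def norm_mult power_mult_distrib)

lemma square_integrable_diff [intro]: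
  assumes "square_integrable M f" "square_integrable M g"
  shows "square_integrable M (\<lambda>x. f x - g x)"
  using square_integrable_add[OF assms(1) square_integrable_cmult[OF assms(2), of "-1"]] by simp

lemma square_integrable_zero [simp]: "square_integrable M (\<lambda>x. 0)"
  by (simp add: square_integrable_def)

lemma square_integrable_sum [intro]:
  "(\<And>i. i \<in> A \<Longrightarrow> square_integrable M (f i)) \<Longrightarrow> square_integrable M (\<lambda>x. \<Sum>i\<in>A. f i x)"
  by (induction A rule: infinite_finite_induct) auto

lemma integrable_mult_cnj [intro]:
  assumes "square_integrable M f" "square_integrable M g"
  shows "integrable M (\<lambda>x. f x * cnj (g x))"
proof -
  have [measurable]: "f \<in> borel_measurable M" "g \<in> borel_measurable M"
    using assms by (auto simp: square_integrable_def)
  have [measurable]: "cnj \<in> borel_measurable borel"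
    by (intro borel_measurable_continuous_onI continuous_intros)
  show ?thesis
    by (rule Bochner_Integration.integrable_bound
          [where f = "\<lambda>x. (cmod (f x))\<^sup>2 / 2 + (cmod (g x))\<^sup>2 / 2"])
       (use assms cmod_mult_le_weighted_squares[of 1 "f _" "cnj (g _)"] in
         \<open>auto simp: norm_mult add_divide_distrib square_integrable_def\<close>)
qed

text \<open>The weighted estimate gives \<open>2 I \<le> t A + B / t\<close> for the modulus \<open>I\<close> of the inner product, the squared norms
  \<open>A\<close>, \<open>B\<close> and every \<open>t > 0\<close>, and \<open>t = I / A\<close> is the right choice. If \<open>A = 0\<close>, a large \<open>t\<close> shows
  \<open>I = 0\<close>.\<close>

lemma Cauchy_Schwarz_square_integrable:
  assumes f: "square_integrable M f" and g: "square_integrable M g"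
  shows "(cmod (LINT x|M. f x * cnj (g x)))\<^sup>2
           \<le> (LINT x|M. (cmod (f x))\<^sup>2) * (LINT x|M. (cmod (g x))\<^sup>2)"
proof -
  define I where "I = cmod (LINT x|M. f x * cnj (g x))"
  define A where "A = (LINT x|M. (cmod (f x))\<^sup>2)"
  define B where "B = (LINT x|M. (cmod (g x))\<^sup>2)"
  have nonneg: "I \<ge> 0" "A \<ge> 0" "B \<ge> 0"
    by (simp_all add: I_def A_def B_def)
  have bound: "I \<le> (t * A + B / t) / 2" if "t > 0" for t
  proof -
    have int: "integrable M (\<lambda>x. (t * (cmod (f x))\<^sup>2 + (cmod (g x))\<^sup>2 / t) / 2)"
      using f g by (auto simp: square_integrable_def)
    have "I \<le> (LINT x|M. cmod (f x * cnj (g x)))"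
      unfolding I_def by (rule integral_norm_bound)
    also have "\<dots> \<le> (LINT x|M. (t * (cmod (f x))\<^sup>2 + (cmod (g x))\<^sup>2 / t) / 2)"
      using integrable_norm[OF integrable_mult_cnj[OF f g]] int
        cmod_mult_le_weighted_squares[OF that, of "f _" "cnj (g _)"]
      by (intro integral_mono) auto
    also have "\<dots> = (t * A + B / t) / 2"
      using f g by (simp add: A_def B_def square_integrable_def)
    finally show ?thesis .
  qed
  have "I\<^sup>2 \<le> A * B"
  proof (cases "I = 0 \<or> A = 0")
    case True
    have "I = 0"
    proof (rule ccontr)
      assume "I \<noteq> 0"
      then have "I > 0" "A = 0" using nonneg True by auto
      moreover from this nonneg have "B / ((B + 1) / I) < I" by (simp add: field_simps)
      moreover from calculation nonneg have "I \<le> B / ((B + 1) / I) / 2"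
        using bound[of "(B + 1) / I"] by simp
      moreover have False if "X < I" "I \<le> X / 2" "0 < I" for X
        using that by linarith
      ultimately show False by blast
    qed
    then show ?thesis using nonneg by simp
  next
    case False
    then show ?thesis
      using bound[of "I / A"] nonneg by (simp add: field_simps power2_eq_square)
  qed
  then show ?thesis by (simp add: I_def A_def B_def)
qed

lemma integral_mult_cnj_tendsto_0:
  assumes f: "\<And>n. square_integrable M (f n)" and g: "square_integrable M g"
    and lim: "(\<lambda>n. LINT x|M. (cmod (f n x))\<^sup>2) \<longlonglongrightarrow> 0"
  shows "(\<lambda>n. LINT x|M. f n x * cnj (g x)) \<longlonglongrightarrow> 0"
proof -
  let ?B = "LINT x|M. (cmod (g x))\<^sup>2"
  have "(\<lambda>n. sqrt ((LINT x|M. (cmod (f n x))\<^sup>2) * ?B)) \<longlonglongrightarrow> sqrt (0 * ?B)"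
    by (intro tendsto_intros lim)
  then have "(\<lambda>n. sqrt ((LINT x|M. (cmod (f n x))\<^sup>2) * ?B)) \<longlonglongrightarrow> 0" by simp
  then show ?thesis
    by (rule Lim_null_comparison[rotated])
       (auto intro!: always_eventually real_le_rsqrt Cauchy_Schwarz_square_integrable f g)
qed

text \<open>The sum of the series has a finite integral by monotone convergence, so it is finite almost
  everywhere.\<close>

lemma AE_summable_of_summable_integrals:
  fixes f :: "nat \<Rightarrow> 'a \<Rightarrow> real"
  assumes int: "\<And>n. integrable M (f n)" and pos: "\<And>n x. 0 \<le> f n x"
    and sum: "summable (\<lambda>n. LINT x|M. f n x)"
  shows "AE x in M. summable (\<lambda>n. f n x)"
proof -
  have [measurable]: "\<And>n. f n \<in> borel_measurable M" using int by auto
  have "(\<integral>\<^sup>+x. (\<Sum>n. ennreal (f n x)) \<partial>M) = (\<Sum>n. \<integral>\<^sup>+x. ennreal (f n x) \<partial>M)"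
    by (rule nn_integral_suminf) measurable
  also have "\<dots> = (\<Sum>n. ennreal (LINT x|M. f n x))"
    by (intro suminf_cong nn_integral_eq_integral int) (simp add: pos)
  also have "\<dots> = ennreal (\<Sum>n. LINT x|M. f n x)"
    by (intro suminf_ennreal2 sum) (simp add: pos)
  finally have "(\<integral>\<^sup>+x. (\<Sum>n. ennreal (f n x)) \<partial>M) \<noteq> \<infinity>" by simp
  then have "AE x in M. (\<Sum>n. ennreal (f n x)) \<noteq> \<infinity>"
    by (intro nn_integral_PInf_AE) auto
  then show ?thesis
    by eventually_elim (auto intro!: summable_suminf_not_top simp: pos)
qed

section \<open>Orthonormal families\<close>

locale orthonormal_family =
  fixes M :: "'a measure" and e :: "'i \<Rightarrow> 'a \<Rightarrow> complex"
  assumes square_integrable_e: "\<And>i. square_integrable M (e i)"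
    and orthonormal: "\<And>i j. (LINT x|M. e i x * cnj (e j x)) = (if i = j then 1 else 0)"
begin

definition coef :: "('a \<Rightarrow> complex) \<Rightarrow> 'i \<Rightarrow> complex" where
  "coef f i = (LINT x|M. f x * cnj (e i x))"

definition comb :: "('i \<Rightarrow> complex) \<Rightarrow> 'i set \<Rightarrow> 'a \<Rightarrow> complex" where
  "comb c A x = (\<Sum>i\<in>A. c i * e i x)"

lemma square_integrable_comb [intro]: "square_integrable M (comb c A)"
  unfolding comb_def[abs_def]
  by (intro square_integrable_sum square_integrable_cmult square_integrable_e)

lemma coef_diff:
  assumes "square_integrable M f" "square_integrable M g"
  shows "coef (\<lambda>x. f x - g x) i = coef f i - coef g i"
proof -
  have "integrable M (\<lambda>x. f x * cnj (e i x))" "integrable M (\<lambda>x. g x * cnj (e i x))"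
    using assms square_integrable_e by auto
  then show ?thesis by (simp add: coef_def algebra_simps)
qed

lemma coef_comb:
  assumes "finite A"
  shows "coef (comb c A) i = (if i \<in> A then c i else 0)"
proof -
  have "coef (comb c A) i = (LINT x|M. (\<Sum>j\<in>A. c j * (e j x * cnj (e i x))))"
    by (simp add: coef_def comb_def sum_distrib_right mult.assoc)
  also have "\<dots> = (\<Sum>j\<in>A. c j * (LINT x|M. e j x * cnj (e i x)))"
    using integrable_mult_cnj[OF square_integrable_e square_integrable_e]
    by (subst Bochner_Integration.integral_sum) auto
  also have "\<dots> = (\<Sum>j\<in>A. if j = i then c j else 0)"
    by (intro sum.cong) (auto simp: orthonormal)
  finally show ?thesis using assms by simp
qed

lemma integral_square_diff_comb:
  assumes f: "square_integrable M f" and "finite A"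
  shows "(LINT x|M. (cmod (f x - comb c A x))\<^sup>2)
     = (LINT x|M. (cmod (f x))\<^sup>2) + (\<Sum>i\<in>A. (cmod (c i))\<^sup>2 - 2 * Re (coef f i * cnj (c i)))"
  using \<open>finite A\<close>
proof (induction A)
  case empty
  then show ?case by (simp add: comb_def)
next
  case (insert i A)
  let ?g = "\<lambda>x. f x - comb c A x"
  have g: "square_integrable M ?g" using f by auto
  have ei: "integrable M (\<lambda>x. (cmod (e i x))\<^sup>2)" "integrable M (\<lambda>x. ?g x * cnj (e i x))"
    using g square_integrable_e by (auto simp: square_integrable_def intro!: integrable_mult_cnj)
  have "complex_of_real (LINT x|M. (cmod (e i x))\<^sup>2) = (LINT x|M. e i x * cnj (e i x))"
    by (simp only: flip: complex_norm_square integral_complex_of_real)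
  then have one: "(LINT x|M. (cmod (e i x))\<^sup>2) = 1"
    by (simp only: orthonormal refl if_True of_real_eq_1_iff)
  have pt: "(cmod (f x - comb c (insert i A) x))\<^sup>2
      = (cmod (?g x))\<^sup>2 + (cmod (c i))\<^sup>2 * (cmod (e i x))\<^sup>2 - 2 * Re (cnj (c i) * (?g x * cnj (e i x)))"
    for x
  proof -
    have eq: "f x - comb c (insert i A) x = ?g x - c i * e i x"
      using insert by (simp add: comb_def)
    have sq: "(cmod (u - v))\<^sup>2 = (cmod u)\<^sup>2 + (cmod v)\<^sup>2 - 2 * Re (u * cnj v)" for u v
      by (simp add: cmod_power2) (simp add: power2_eq_square algebra_simps)
    show ?thesis
      unfolding eq sq[of "?g x"] by (simp add: norm_mult power_mult_distrib mult_ac del: complex_cnj_diff)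
  qed
  have I1: "integrable M (\<lambda>x. (cmod (?g x))\<^sup>2)"
    and I2: "integrable M (\<lambda>x. (cmod (c i))\<^sup>2 * (cmod (e i x))\<^sup>2)"
    using square_integrableD[OF g] ei(1) by auto
  have I3: "integrable M (\<lambda>x. Re (cnj (c i) * (?g x * cnj (e i x))))"
    by (intro integrable_Re integrable_mult_right ei)
  have "(LINT x|M. (cmod (f x - comb c (insert i A) x))\<^sup>2)
      = (LINT x|M. (cmod (?g x))\<^sup>2) + (cmod (c i))\<^sup>2 * (LINT x|M. (cmod (e i x))\<^sup>2)
        - 2 * (LINT x|M. Re (cnj (c i) * (?g x * cnj (e i x))))"
    unfolding pt by (simp only: Bochner_Integration.integral_add[OF I1 I2] integral_mult_right_zero
        Bochner_Integration.integral_diff[OF Bochner_Integration.integrable_add[OF I1 I2]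
          integrable_mult_right[OF I3]])
  also have "(LINT x|M. Re (cnj (c i) * (?g x * cnj (e i x)))) = Re (cnj (c i) * coef ?g i)"
    unfolding coef_def
    by (simp only: integral_mult_right_zero integral_Re[OF integrable_mult_right[OF ei(2)]])
  also have "coef ?g i = coef f i"
    using insert f by (subst coef_diff) (auto simp: coef_comb)
  finally show ?case
    using insert one by (simp add: algebra_simps)
qed

lemma integral_square_comb:
  assumes "finite A"
  shows "(LINT x|M. (cmod (comb c A x))\<^sup>2) = (\<Sum>i\<in>A. (cmod (c i))\<^sup>2)"
  using integral_square_diff_comb[OF square_integrable_zero assms, of c] by (simp add: coef_def)

text \<open>The best approximation of \<open>f\<close> by a combination of finitely many basis vectors is the one with
  the coefficients of \<open>f\<close>; its error is what Bessel's inequality leaves over.\<close>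

lemma Bessel_defect:
  assumes "square_integrable M f" "finite A" "\<And>i. i \<in> A \<Longrightarrow> coef f i = c i"
  shows "(LINT x|M. (cmod (f x - comb c A x))\<^sup>2)
      = (LINT x|M. (cmod (f x))\<^sup>2) - (\<Sum>i\<in>A. (cmod (c i))\<^sup>2)"
proof -
  have "Re (coef f i * cnj (c i)) = (cmod (c i))\<^sup>2" if "i \<in> A" for i
    using assms(3)[OF that] by (simp add: cmod_power2) (simp add: power2_eq_square)
  then show ?thesis
    by (simp add: integral_square_diff_comb[OF assms(1,2)] sum_subtractf sum_negf)
qed

lemma Bessel_summable:
  assumes f: "square_integrable M f"
  shows "(\<lambda>i. (cmod (coef f i))\<^sup>2) summable_on UNIV"
proof (rule nonneg_bounded_partial_sums_imp_summable_on)
  have "(\<Sum>i\<in>A. (cmod (coef f i))\<^sup>2) \<le> (LINT x|M. (cmod (f x))\<^sup>2)" if "finite A" for A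
    using Bessel_defect[OF f that refl] Bochner_Integration.integral_nonneg[of M "\<lambda>x. (cmod (f x - comb (coef f) A x))\<^sup>2"]
    by simp
  then show "\<forall>\<^sub>F A in finite_subsets_at_top UNIV.
      (\<Sum>i\<in>A. (cmod (coef f i))\<^sup>2) \<le> (LINT x|M. (cmod (f x))\<^sup>2)"
    by (intro eventually_finite_subsets_at_top_weakI) auto
qed simp


text \<open>The finite sets \<open>A k\<close> exhaust the sum of squares up to \<open>4\<^sup>-\<^sup>k\<close>, so the differences
  \<open>d\<^sub>k\<close> of consecutive partial sums satisfy \<open>\<parallel>d\<^sub>k\<parallel>\<^sup>2 \<le> 4\<^sup>-\<^sup>k\<close>. Hence \<open>\<Sum>2\<^sup>k |d\<^sub>k|\<^sup>2\<close> converges almost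
  everywhere, and \<open>2|d\<^sub>k| \<le> 2\<^sup>k |d\<^sub>k|\<^sup>2 + 2\<^sup>-\<^sup>k\<close> makes the partial sums converge pointwise;
  Fatou's lemma turns pointwise convergence into convergence in norm. The index set may be
  uncountable.\<close>

lemma Riesz_Fischer:
  assumes c: "(\<lambda>i. (cmod (c i))\<^sup>2) summable_on UNIV"
  obtains f where "square_integrable M f" "\<And>i. coef f i = c i"
    "((\<lambda>i. (cmod (c i))\<^sup>2) has_sum (LINT x|M. (cmod (f x))\<^sup>2)) UNIV"
proof -
  define S where "S = (\<Sum>\<^sub>\<infinity>i. (cmod (c i))\<^sup>2)"
  have hs: "((\<lambda>i. (cmod (c i))\<^sup>2) has_sum S) UNIV"
    unfolding S_def using c by simp
  have upper: "(\<Sum>i\<in>B. (cmod (c i))\<^sup>2) \<le> S" if "finite B" for B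
    by (rule finite_sum_le_has_sum[OF hs that]) auto
  have "\<exists>B. finite B \<and> S - (1/4)^k < (\<Sum>i\<in>B. (cmod (c i))\<^sup>2)" for k :: nat
  proof -
    obtain B where "finite B" "dist (\<Sum>i\<in>B. (cmod (c i))\<^sup>2) S \<le> (1/4)^k / 2"
      using has_sum_finite_approximation[OF hs, of "(1/4)^k / 2"] by auto
    moreover have "(0::real) < (1/4)^k" by simp
    ultimately have "S - (1/4)^k < (\<Sum>i\<in>B. (cmod (c i))\<^sup>2)"
      unfolding dist_real_def by linarith
    then show ?thesis using \<open>finite B\<close> by blast
  qed
  then obtain B where B: "\<And>k::nat. finite (B k)"
      "\<And>k::nat. S - (1/4)^k < (\<Sum>i\<in>B k. (cmod (c i))\<^sup>2)"
    by metis
  define A where "A k = (\<Union>l\<le>k. B l)" for k :: nat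
  have fin: "finite (A k)" for k
    by (simp add: A_def B)
  have A_mono: "A k \<subseteq> A l" if "k \<le> l" for k l
    using that unfolding A_def by force
  have lower: "S - (1/4)^k < (\<Sum>i\<in>A k. (cmod (c i))\<^sup>2)" for k
    using B(2)[of k] sum_mono2[OF fin, of "B k" k "\<lambda>i. (cmod (c i))\<^sup>2"]
    by (force simp: A_def)
  have tail: "(\<Sum>i\<in>E. (cmod (c i))\<^sup>2) \<le> (1/4)^k" if "finite E" "E \<inter> A k = {}" for E k
    using upper[of "E \<union> A k"] that fin[of k] lower[of k] by (simp add: sum.union_disjoint)
  define s where "s k = comb c (A k)" for k
  have s_si: "square_integrable M (s k)" for k
    by (auto simp: s_def)
  then have s_meas [measurable]: "s k \<in> borel_measurable M" for k
    by (rule square_integrableD)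
  have gap: "(LINT x|M. (cmod (s l x - s k x))\<^sup>2) \<le> (1/4)^k" if "k \<le> l" for k l
  proof -
    have "s l x - s k x = comb c (A l - A k) x" for x
      by (simp add: s_def comb_def sum_diff[OF fin A_mono[OF that]])
    then show ?thesis
      using tail[of "A l - A k" k] fin by (simp add: integral_square_comb Int_commute)
  qed

  have "AE x in M. summable (\<lambda>k. 2^k * (cmod (s (Suc k) x - s k x))\<^sup>2)"
  proof (rule AE_summable_of_summable_integrals)
    show "integrable M (\<lambda>x. 2^k * (cmod (s (Suc k) x - s k x))\<^sup>2)" for k
      using square_integrable_diff[OF s_si s_si] by (simp add: square_integrable_def)
    have "2^k * (LINT x|M. (cmod (s (Suc k) x - s k x))\<^sup>2) \<le> (1/2)^k" for k
      using mult_left_mono[OF gap[of k "Suc k"], of "2^k"]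
      by (simp flip: power_mult_distrib)
    then have "norm (LINT x|M. 2^k * (cmod (s (Suc k) x - s k x))\<^sup>2) \<le> (1/2)^k" for k
      by (simp only: integral_mult_right_zero real_norm_def abs_mult power_abs abs_numeral
          abs_of_nonneg Bochner_Integration.integral_nonneg zero_le_power2)
    moreover have "summable (\<lambda>k. (1/2::real)^k)" by simp
    ultimately show "summable (\<lambda>k. LINT x|M. 2^k * (cmod (s (Suc k) x - s k x))\<^sup>2)"
      by (rule summable_comparison_test'[of _ 0, rotated])
  qed simp
  then have conv: "AE x in M. convergent (\<lambda>k. s k x)"
  proof eventually_elim
    case (elim x)
    have "summable (\<lambda>k. (2^k * (cmod (s (Suc k) x - s k x))\<^sup>2 + (1/2)^k) / 2)"
      by (intro summable_divide summable_add elim) simp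
    moreover have "cmod (s (Suc k) x - s k x)
        \<le> (2^k * (cmod (s (Suc k) x - s k x))\<^sup>2 + (1/2)^k) / 2" for k
      using cmod_mult_le_weighted_squares[of "2^k" "s (Suc k) x - s k x" 1]
      by (simp add: power_one_over)
    ultimately have "summable (\<lambda>k. s (Suc k) x - s k x)"
      by (rule summable_comparison_test'[where N = 0])
    then show ?case
      unfolding summable_iff_convergent sum_lessThan_telescope[of "\<lambda>k. s k x"]
        convergent_diff_const_right_iff .
  qed

  define f where "f x = lim (\<lambda>k. s k x)" for x
  have [measurable]: "f \<in> borel_measurable M"
    unfolding f_def[abs_def] by measurable
  have fatou: "(\<integral>\<^sup>+x. ennreal ((cmod (f x - s k x))\<^sup>2) \<partial>M) \<le> ennreal ((1/4)^k)" for k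
  proof -
    have "(\<integral>\<^sup>+x. ennreal ((cmod (f x - s k x))\<^sup>2) \<partial>M)
        = (\<integral>\<^sup>+x. liminf (\<lambda>l. ennreal ((cmod (s l x - s k x))\<^sup>2)) \<partial>M)"
    proof (rule nn_integral_cong_AE, use conv in eventually_elim)
      case (elim x)
      then have "(\<lambda>l. s l x) \<longlonglongrightarrow> f x"
        unfolding f_def by (simp add: convergent_LIMSEQ_iff)
      then have "(\<lambda>l. ennreal ((cmod (s l x - s k x))\<^sup>2)) \<longlonglongrightarrow> ennreal ((cmod (f x - s k x))\<^sup>2)"
        by (intro tendsto_intros tendsto_ennrealI)
      then show ?case
        by (rule lim_imp_Liminf[symmetric, OF trivial_limit_sequentially])
    qed
    also have "\<dots> \<le> liminf (\<lambda>l. \<integral>\<^sup>+x. ennreal ((cmod (s l x - s k x))\<^sup>2) \<partial>M)"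
      by (rule nn_integral_liminf) measurable
    also have "\<dots> \<le> ennreal ((1/4)^k)"
    proof (rule Liminf_le)
      show "\<forall>\<^sub>F l in sequentially. (\<integral>\<^sup>+x. ennreal ((cmod (s l x - s k x))\<^sup>2) \<partial>M) \<le> ennreal ((1/4)^k)"
      proof (rule eventually_sequentiallyI[of k])
        fix l assume "k \<le> l"
        have "(\<integral>\<^sup>+x. ennreal ((cmod (s l x - s k x))\<^sup>2) \<partial>M)
            = ennreal (LINT x|M. (cmod (s l x - s k x))\<^sup>2)"
          using square_integrable_diff[OF s_si s_si]
          by (intro nn_integral_eq_integral) (auto simp: square_integrable_def)
        then show "(\<integral>\<^sup>+x. ennreal ((cmod (s l x - s k x))\<^sup>2) \<partial>M) \<le> ennreal ((1/4)^k)"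
          using gap[OF \<open>k \<le> l\<close>] by (simp add: ennreal_leI)
      qed
    qed simp
    finally show ?thesis .
  qed
  have diff_si: "square_integrable M (\<lambda>x. f x - s k x)" for k
    unfolding square_integrable_def
    using fatou[of k] by (auto intro!: integrableI_nonneg intro: le_less_trans)
  have f_si: "square_integrable M f"
    using square_integrable_add[OF diff_si[of 0] s_si[of 0]] by simp
  have close: "(LINT x|M. (cmod (f x - s k x))\<^sup>2) \<le> (1/4)^k" for k
  proof -
    have "ennreal (LINT x|M. (cmod (f x - s k x))\<^sup>2) \<le> ennreal ((1/4)^k)"
      using fatou[of k] diff_si[of k]
      by (subst nn_integral_eq_integral[symmetric]) (auto simp: square_integrable_def)
    then show ?thesis by (simp add: ennreal_le_iff)
  qed
  have quarter: "(\<lambda>k. (1/4::real)^k) \<longlonglongrightarrow> 0" and half: "(\<lambda>k. (1/2::real)^k) \<longlonglongrightarrow> 0"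
    by (simp_all add: LIMSEQ_power_zero)
  have null: "(\<lambda>k. LINT x|M. (cmod (f x - s k x))\<^sup>2) \<longlonglongrightarrow> 0"
    by (rule Lim_null_comparison[OF _ quarter]) (use close in auto)
  have coef_f: "coef f i = c i" for i
  proof -
    have "(\<lambda>k. coef f i - coef (s k) i) \<longlonglongrightarrow> 0"
      using integral_mult_cnj_tendsto_0[OF diff_si square_integrable_e null, of i]
        coef_diff[OF f_si s_si] by (simp add: coef_def)
    moreover have "(\<lambda>k. coef (s k) i - c i) \<longlonglongrightarrow> 0"
    proof (rule Lim_null_comparison[OF _ half], rule always_eventually, rule allI)
      fix k
      have "(cmod (c i))\<^sup>2 \<le> ((1/2)^k)\<^sup>2" if "i \<notin> A k"
        using tail[of "{i}" k] that by (simp add: power2_eq_square flip: power_mult_distrib)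
      then show "cmod (coef (s k) i - c i) \<le> (1/2)^k"
        by (auto simp: s_def coef_comb fin intro: power2_le_imp_le)
    qed
    ultimately have "(\<lambda>k. coef f i - c i) \<longlonglongrightarrow> 0 + 0"
      by (drule_tac tendsto_add) auto
    then show ?thesis by (simp add: LIMSEQ_const_iff)
  qed
  have "(\<lambda>k. \<Sum>i\<in>A k. (cmod (c i))\<^sup>2) \<longlonglongrightarrow> (LINT x|M. (cmod (f x))\<^sup>2)"
    using tendsto_diff[OF tendsto_const[of "LINT x|M. (cmod (f x))\<^sup>2"] null]
    by (simp add: s_def Bessel_defect[OF f_si fin coef_f])
  moreover have "(\<lambda>k. S - (\<Sum>i\<in>A k. (cmod (c i))\<^sup>2)) \<longlonglongrightarrow> 0"
    by (rule Lim_null_comparison[OF _ quarter])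
       (use upper[OF fin] lower in \<open>auto intro!: always_eventually simp: less_imp_le algebra_simps\<close>)
  ultimately have "(\<lambda>k. S) \<longlonglongrightarrow> (LINT x|M. (cmod (f x))\<^sup>2) + 0"
    by (drule_tac tendsto_add) auto
  then have "S = (LINT x|M. (cmod (f x))\<^sup>2)"
    by (simp add: LIMSEQ_const_iff)
  then show ?thesis
    using that f_si coef_f hs by simp
qed

end

locale orthonormal_basis = orthonormal_family +
  assumes total: "\<And>f. square_integrable M f \<Longrightarrow> (\<And>i. coef f i = 0) \<Longrightarrow> AE x in M. f x = 0"
begin

text \<open>A function has the same coefficients as the one that Riesz--Fischer supplies for them, so by
  totality the two agree almost everywhere, and their norms coincide.\<close>

lemma Parseval:
  assumes f: "square_integrable M f"
  shows "((\<lambda>i. (cmod (coef f i))\<^sup>2) has_sum (LINT x|M. (cmod (f x))\<^sup>2)) UNIV"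
proof -
  obtain g where g: "square_integrable M g" "\<And>i. coef g i = coef f i"
      "((\<lambda>i. (cmod (coef f i))\<^sup>2) has_sum (LINT x|M. (cmod (g x))\<^sup>2)) UNIV"
    using Riesz_Fischer[OF Bessel_summable[OF f]] by blast
  have "AE x in M. f x - g x = 0"
    using f g by (intro total) (auto simp: coef_diff)
  then have "(LINT x|M. (cmod (g x))\<^sup>2) = (LINT x|M. (cmod (f x))\<^sup>2)"
    using f g by (intro integral_cong_AE) (auto simp: square_integrable_def)
  then show ?thesis using g(3) by simp
qed

end

section \<open>Characters separate points\<close>

abbreviation additive_monoid :: "'b::ab_group_add monoid" where
  "additive_monoid \<equiv> \<lparr>carrier = UNIV, mult = (+), one = 0\<rparr>"

lemma group_additive_monoid: "group (additive_monoid :: 'b::ab_group_add monoid)"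
  by (rule groupI) (auto simp: add.assoc intro: exI[of _ "- _"] left_minus)

definition zmul :: "int \<Rightarrow> 'b::ab_group_add \<Rightarrow> 'b" where
  "zmul k x = x [^]\<^bsub>additive_monoid\<^esub> k"

lemma zmul_0 [simp]: "zmul 0 x = 0" and zmul_1 [simp]: "zmul 1 x = x"
  using group.int_pow_1[OF group_additive_monoid, of x]
  by (simp_all add: zmul_def)

lemma zmul_add: "zmul (j + k) x = zmul j x + zmul k x"
  using group.int_pow_mult[OF group_additive_monoid, of x j k] by (simp add: zmul_def)

lemma zmul_mult: "zmul (j * k) x = zmul k (zmul j x)"
  using group.int_pow_pow[OF group_additive_monoid, of x j k] by (simp add: zmul_def)

lemma zmul_minus: "zmul (- k) x = - zmul k x"
  using zmul_add[of "-k" k x] by (simp add: eq_neg_iff_add_eq_0)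

lemma zmul_diff: "zmul (j - k) x = zmul j x - zmul k x"
  using zmul_add[of j "-k" x] by (simp add: zmul_minus)

text \<open>A partial character, that is a homomorphism from a subgroup to the unit circle, is encoded as
  its graph, so that extension is inclusion and unions of chains are immediate.\<close>

definition partial_character :: "('b::ab_group_add \<times> complex) set \<Rightarrow> bool" where
  "partial_character \<Gamma> \<longleftrightarrow> (0, 1) \<in> \<Gamma> \<and>
     (\<forall>a u b v. (a, u) \<in> \<Gamma> \<longrightarrow> (b, v) \<in> \<Gamma> \<longrightarrow> (a - b, u / v) \<in> \<Gamma>) \<and>
     (\<forall>a u. (a, u) \<in> \<Gamma> \<longrightarrow> cmod u = 1) \<and>
     (\<forall>u. (0, u) \<in> \<Gamma> \<longrightarrow> u = 1)"

lemma partial_characterD: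
  assumes "partial_character \<Gamma>"
  shows "(0, 1) \<in> \<Gamma>" "(a, u) \<in> \<Gamma> \<Longrightarrow> (b, v) \<in> \<Gamma> \<Longrightarrow> (a - b, u / v) \<in> \<Gamma>"
    "(a, u) \<in> \<Gamma> \<Longrightarrow> cmod u = 1" "(0, u) \<in> \<Gamma> \<Longrightarrow> u = 1"
  using assms unfolding partial_character_def by blast+

lemma partial_character_uminus:
  assumes "partial_character \<Gamma>" "(a, u) \<in> \<Gamma>"
  shows "(- a, inverse u) \<in> \<Gamma>"
  using partial_characterD(2)[OF assms(1) partial_characterD(1)[OF assms(1)] assms(2)]
  by (simp add: divide_inverse)

lemma partial_character_add:
  assumes "partial_character \<Gamma>" "(a, u) \<in> \<Gamma>" "(b, v) \<in> \<Gamma>"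
  shows "(a + b, u * v) \<in> \<Gamma>"
  using partial_characterD(2)[OF assms(1,2) partial_character_uminus[OF assms(1,3)]]
  by (simp add: divide_inverse)

lemma partial_character_zmul:
  assumes "partial_character \<Gamma>" "(a, u) \<in> \<Gamma>"
  shows "(zmul k a, u powi k) \<in> \<Gamma>"
proof (induction k rule: int_induct[of _ 0])
  case base
  then show ?case using partial_characterD(1)[OF assms(1)] by simp
next
  case (step1 i)
  have "u \<noteq> 0" using partial_characterD(3)[OF assms] by auto
  then show ?case
    using partial_character_add[OF assms(1) step1(2) assms(2)]
    by (simp add: zmul_add power_int_add)
next
  case (step2 i)
  have "u \<noteq> 0" using partial_characterD(3)[OF assms] by auto
  then show ?case
    using partial_characterD(2)[OF assms(1) step2(2) assms(2)]
    by (simp add: zmul_diff power_int_diff)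
qed

lemma partial_character_functional:
  assumes "partial_character \<Gamma>" "(a, u) \<in> \<Gamma>" "(a, v) \<in> \<Gamma>"
  shows "u = v"
proof -
  have "(0, u / v) \<in> \<Gamma>" using partial_characterD(2)[OF assms] by simp
  then have "u / v = 1" by (rule partial_characterD(4)[OF assms(1)])
  then show ?thesis using partial_characterD(3)[OF assms(1,3)] by (auto simp: divide_eq_1_iff)
qed

text \<open>The argument \<open>(Arg z + 2\<pi>) / n\<close> lies strictly between \<open>0\<close> and \<open>2\<pi>\<close> as soon as \<open>n \<ge> 2\<close>,
  so the root with this argument is not \<open>1\<close>.\<close>

lemma exists_nontrivial_unit_root:
  assumes "cmod z = 1" "n \<ge> (2::nat)"
  obtains w where "cmod w = 1" "w \<noteq> 1" "w ^ n = z"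
proof
  let ?t = "(Arg z + 2 * pi) / n"
  show "cmod (cis ?t) = 1" by simp
  have "cis ?t ^ n = cis (real n * ?t)" by (rule Complex.DeMoivre)
  also have "\<dots> = cis (Arg z + 2 * pi)" using assms(2) by simp
  also have "\<dots> = cis (Arg z)" by (simp flip: cis_mult)
  also have "\<dots> = z" using assms(1) by (subst cis_Arg) (auto simp: sgn_eq)
  finally show "cis ?t ^ n = z" .
  have "-pi < Arg z" "Arg z \<le> pi" by (simp_all add: Arg_bounded mpi_less_Arg Arg_le_pi)
  then have "0 < ?t" using assms(2) by simp
  moreover have "?t \<le> (3 * pi) / 2"
    by (rule frac_le) (use assms(2) \<open>Arg z \<le> pi\<close> in auto)
  moreover have False if "?t = real_of_int m * 2 * pi" for m
  proof -
    have "0 < real_of_int m" using that \<open>0 < ?t\<close> by (simp add: zero_less_mult_iff)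
    then have "1 \<le> real_of_int m" by simp
    then have "1 * (2 * pi) \<le> real_of_int m * (2 * pi)" by (intro mult_right_mono) auto
    then show False using that \<open>?t \<le> (3 * pi) / 2\<close> pi_gt_zero by (simp add: mult.assoc)
  qed
  ultimately have "cos ?t \<noteq> 1"
    unfolding cos_one_2pi_int by blast
  then show "cis ?t \<noteq> 1" by (metis cis.simps(1) one_complex.simps(1))
qed

text \<open>The circle is divisible: if a multiple \<open>nx\<close> of the new element with least \<open>n > 0\<close> lies in the
  domain already, the value at \<open>x\<close> has to be an \<open>n\<close>-th root of the value at \<open>nx\<close>, and otherwise it is
  arbitrary. Since \<open>n \<ge> 2\<close>, a value other than \<open>1\<close> is always possible.\<close>

lemma partial_character_extend:
  assumes \<Gamma>: "partial_character \<Gamma>" and x: "x \<notin> Domain \<Gamma>"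
  obtains \<Gamma>' w where "partial_character \<Gamma>'" "\<Gamma> \<subseteq> \<Gamma>'" "(x, w) \<in> \<Gamma>'" "w \<noteq> 1"
proof -
  note \<Gamma>D = partial_characterD[OF \<Gamma>]
  obtain w where w: "cmod w = 1" "w \<noteq> 1"
    and compat: "\<And>k v. (zmul k x, v) \<in> \<Gamma> \<Longrightarrow> v = w powi k"
  proof (cases "\<exists>n::nat. n > 0 \<and> zmul (int n) x \<in> Domain \<Gamma>")
    case False
    have "k = 0" if "(zmul k x, v) \<in> \<Gamma>" for k v
    proof (rule ccontr)
      assume "k \<noteq> 0"
      have "zmul k x \<in> Domain \<Gamma>" "zmul (- k) x \<in> Domain \<Gamma>"
        using that partial_character_uminus[OF \<Gamma>] by (auto simp: zmul_minus)
      then have "zmul (int (nat \<bar>k\<bar>)) x \<in> Domain \<Gamma>" by (simp add: abs_if)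
      then show False using False \<open>k \<noteq> 0\<close> by (metis zero_less_abs_iff zero_less_nat_eq)
    qed
    then show ?thesis
      using that[of "-1"] \<Gamma>D(4) by fastforce
  next
    case True
    define n where "n = (LEAST n::nat. n > 0 \<and> zmul (int n) x \<in> Domain \<Gamma>)"
    have n: "n > 0" "zmul (int n) x \<in> Domain \<Gamma>"
      using LeastI_ex[OF True] by (auto simp: n_def)
    have least: "m = 0" if "m < n" "zmul (int m) x \<in> Domain \<Gamma>" for m
      using not_less_Least[of m "\<lambda>n. n > 0 \<and> zmul (int n) x \<in> Domain \<Gamma>"] that
      by (auto simp: n_def)
    obtain z where z: "(zmul (int n) x, z) \<in> \<Gamma>" using n by auto
    have "n \<noteq> 1" using n(2) x by auto
    then have "n \<ge> 2" using n(1) by auto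
    then obtain w where w: "cmod w = 1" "w \<noteq> 1" "w ^ n = z"
      using exists_nontrivial_unit_root[OF \<Gamma>D(3)[OF z]] by blast
    have "v = w powi k" if k: "(zmul k x, v) \<in> \<Gamma>" for k v
    proof -
      let ?q = "k div int n" and ?r = "k mod int n"
      have kq: "(zmul (int n * ?q) x, z powi ?q) \<in> \<Gamma>"
        using partial_character_zmul[OF \<Gamma> z] by (simp add: zmul_mult)
      have "(zmul (k - int n * ?q) x, v / z powi ?q) \<in> \<Gamma>"
        using \<Gamma>D(2)[OF k kq] by (simp add: zmul_diff)
      then have "zmul ?r x \<in> Domain \<Gamma>"
        by (auto simp: minus_mult_div_eq_mod)
      then have "nat ?r = 0"
        using least[of "nat ?r"] n(1) by (simp add: nat_less_iff)
      then have "?r = 0" using n(1) by (smt (verit) nat_0_iff pos_mod_sign of_nat_0_less_iff)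
      then have keq: "k = int n * ?q" by auto
      then have "v = z powi ?q"
        using partial_character_functional[OF \<Gamma> k] kq by metis
      also have "\<dots> = w powi (int n * ?q)"
        by (simp add: power_int_mult w(3))
      finally show ?thesis using keq by simp
    qed
    then show ?thesis using that w by blast
  qed
  have "w \<noteq> 0" using w by auto
  define \<Gamma>' where "\<Gamma>' = {(a + zmul k x, u * w powi k) | a u k. (a, u) \<in> \<Gamma>}"
  have mem: "(a + zmul k x, u * w powi k) \<in> \<Gamma>'" if "(a, u) \<in> \<Gamma>" for a u k
    using that by (auto simp: \<Gamma>'_def)
  have "partial_character \<Gamma>'"
    unfolding partial_character_def
  proof (intro conjI allI impI)
    show "(0, 1) \<in> \<Gamma>'" using mem[OF \<Gamma>D(1), of 0] by simp
  next
    fix a u b v assume "(a, u) \<in> \<Gamma>'" "(b, v) \<in> \<Gamma>'"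
    then obtain a' u' j b' v' k where "(a', u') \<in> \<Gamma>" "a = a' + zmul j x" "u = u' * w powi j"
      "(b', v') \<in> \<Gamma>" "b = b' + zmul k x" "v = v' * w powi k"
      by (auto simp: \<Gamma>'_def)
    then show "(a - b, u / v) \<in> \<Gamma>'"
      using mem[OF \<Gamma>D(2)[of a' u' b' v'], of "j - k"] \<open>w \<noteq> 0\<close>
      by (simp add: zmul_diff power_int_diff algebra_simps)
  next
    fix a u assume "(a, u) \<in> \<Gamma>'"
    then show "cmod u = 1" using \<Gamma>D(3) w by (auto simp: \<Gamma>'_def norm_mult norm_power_int)
  next
    fix u assume "(0, u) \<in> \<Gamma>'"
    then obtain a v k where *: "(a, v) \<in> \<Gamma>" "a + zmul k x = 0" "u = v * w powi k"
      by (auto simp: \<Gamma>'_def)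
    then have "zmul k x = - a" by (metis add_eq_0_iff)
    then have "inverse v = w powi k"
      using partial_character_uminus[OF \<Gamma> *(1)] compat by metis
    then show "u = 1"
      using *(3) \<Gamma>D(3)[OF *(1)] by (metis norm_zero right_inverse zero_neq_one)
  qed
  moreover have "\<Gamma> \<subseteq> \<Gamma>'" using mem[of _ _ 0] by auto
  moreover have "(x, w) \<in> \<Gamma>'" using mem[OF \<Gamma>D(1), of 1] by simp
  ultimately show ?thesis using that w(2) by blast
qed

text \<open>The trivial character on \<open>{0}\<close> is first extended by a value \<open>\<noteq> 1\<close> at \<open>b\<close>. A maximal extension
  of the result is defined everywhere, because otherwise it could be extended once more.\<close>

lemma dual_group_separates_0:
  fixes b :: "'b::ab_group_add"
  assumes "b \<noteq> 0"
  obtains \<xi> where "\<xi> \<in> dual_group" "\<xi> b \<noteq> 1"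
proof -
  have trivial: "partial_character {(0::'b, 1)}" by (simp add: partial_character_def)
  have "b \<notin> Domain {(0::'b, 1::complex)}" using assms by auto
  then obtain \<Gamma>0 w where \<Gamma>0: "partial_character \<Gamma>0" "(b, w) \<in> \<Gamma>0" "w \<noteq> 1"
    using partial_character_extend[OF trivial] by metis
  define \<A> where "\<A> = {\<Gamma>. partial_character \<Gamma> \<and> \<Gamma>0 \<subseteq> \<Gamma>}"
  have "\<exists>\<Gamma>\<in>\<A>. \<forall>X\<in>\<A>. \<Gamma> \<subseteq> X \<longrightarrow> X = \<Gamma>"
  proof (rule subset_Zorn_nonempty)
    show "\<A> \<noteq> {}" using \<Gamma>0(1) by (auto simp: \<A>_def)
  next
    fix \<C> assume "\<C> \<noteq> {}" and chain: "subset.chain \<A> \<C>"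
    then obtain \<Gamma>1 where "\<Gamma>1 \<in> \<C>" by auto
    have sub: "\<C> \<subseteq> \<A>" and tot: "\<And>X Y. X \<in> \<C> \<Longrightarrow> Y \<in> \<C> \<Longrightarrow> X \<subseteq> Y \<or> Y \<subseteq> X"
      using chain by (auto simp: subset_chain_def)
    have pc: "partial_character X" if "X \<in> \<C>" for X
      using sub that by (auto simp: \<A>_def)
    have "partial_character (\<Union>\<C>)"
      unfolding partial_character_def
    proof (intro conjI allI impI)
      show "(0, 1) \<in> \<Union>\<C>" using partial_characterD(1)[OF pc] \<open>\<Gamma>1 \<in> \<C>\<close> by blast
    next
      fix a u b v assume "(a, u) \<in> \<Union>\<C>" "(b, v) \<in> \<Union>\<C>"
      then obtain X where "X \<in> \<C>" "(a, u) \<in> X" "(b, v) \<in> X" using tot by blast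
      then show "(a - b, u / v) \<in> \<Union>\<C>" using partial_characterD(2)[OF pc] by blast
    next
      show "cmod u = 1" if "(a, u) \<in> \<Union>\<C>" for a u
        using that partial_characterD(3)[OF pc] by blast
      show "u = 1" if "(0, u) \<in> \<Union>\<C>" for u
        using that partial_characterD(4)[OF pc] by blast
    qed
    moreover have "\<Gamma>0 \<subseteq> \<Union>\<C>" using \<open>\<Gamma>1 \<in> \<C>\<close> sub by (auto simp: \<A>_def)
    ultimately show "\<Union>\<C> \<in> \<A>" by (simp add: \<A>_def)
  qed
  then obtain \<Gamma> where mem: "\<Gamma> \<in> \<A>" and max: "\<forall>X\<in>\<A>. \<Gamma> \<subseteq> X \<longrightarrow> X = \<Gamma>"
    by (rule bexE)
  have \<Gamma>: "partial_character \<Gamma>" "\<Gamma>0 \<subseteq> \<Gamma>"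
    using mem by (simp_all add: \<A>_def)
  have maximal: "X = \<Gamma>" if "partial_character X" "\<Gamma> \<subseteq> X" for X
    using max that \<Gamma>(2) by (simp add: \<A>_def)
  have "a \<in> Domain \<Gamma>" for a
  proof (rule ccontr)
    assume "a \<notin> Domain \<Gamma>"
    then obtain \<Gamma>' w' where "partial_character \<Gamma>'" "\<Gamma> \<subseteq> \<Gamma>'" "(a, w') \<in> \<Gamma>'"
      using partial_character_extend[OF \<Gamma>(1)] by metis
    then show False using maximal \<open>a \<notin> Domain \<Gamma>\<close> by blast
  qed
  then have "\<forall>a. \<exists>u. (a, u) \<in> \<Gamma>" by blast
  then obtain \<xi> where \<xi>: "\<And>a. (a, \<xi> a) \<in> \<Gamma>" by metis
  note unique = partial_character_functional[OF \<Gamma>(1)]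
  have "\<xi> \<in> dual_group"
    unfolding dual_group_def
    by (intro CollectI conjI allI partial_characterD(3)[OF \<Gamma>(1) \<xi>]
        unique[OF \<xi> partial_character_add[OF \<Gamma>(1) \<xi> \<xi>]])
  moreover have "\<xi> b = w" by (rule unique[OF \<xi> subsetD[OF \<Gamma>(2) \<Gamma>0(2)]])
  ultimately show ?thesis using that \<Gamma>0(3) by simp
qed

section \<open>The dual group as a compact space\<close>

lemma open_evaluation_vimage:
  "open W \<Longrightarrow> open ((\<lambda>h :: 'a \<Rightarrow> 'b::topological_space. h a) -` W)"
  by (intro open_vimage continuous_on_product_coordinates)

text \<open>A separation axiom for the values is inherited by the topology of pointwise convergence: two
  functions that differ are separated at a point where they differ. Each of the three axioms needs its
  own instance, since a class may not have a more general arity than its superclasses.\<close>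

instance "fun" :: (type, t0_space) t0_space
proof
  fix f g :: "'a \<Rightarrow> 'b"
  assume "f \<noteq> g"
  then obtain a where "f a \<noteq> g a" by auto
  from t0_space_class.t0_space[OF this] obtain U where "open U" "\<not> (f a \<in> U \<longleftrightarrow> g a \<in> U)"
    by (elim exE conjE)
  then show "\<exists>U. open U \<and> \<not> (f \<in> U \<longleftrightarrow> g \<in> U)"
    by (intro exI[of _ "(\<lambda>h. h a) -` U"]) (auto simp: open_evaluation_vimage)
qed

instance "fun" :: (type, t1_space) t1_space
proof
  fix f g :: "'a \<Rightarrow> 'b"
  assume "f \<noteq> g"
  then obtain a where "f a \<noteq> g a" by auto
  from t1_space[OF this] obtain U where "open U" "f a \<in> U" "g a \<notin> U"
    by (elim exE conjE)
  then show "\<exists>U. open U \<and> f \<in> U \<and> g \<notin> U"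
    by (intro exI[of _ "(\<lambda>h. h a) -` U"]) (auto simp: open_evaluation_vimage)
qed

instance "fun" :: (type, t2_space) t2_space
proof
  fix f g :: "'a \<Rightarrow> 'b"
  assume "f \<noteq> g"
  then obtain a where "f a \<noteq> g a" by auto
  from hausdorff[OF this]
  obtain U V where "open U" "open V" "f a \<in> U" "g a \<in> V" "U \<inter> V = {}"
    by (elim exE conjE)
  then show "\<exists>U V. open U \<and> open V \<and> f \<in> U \<and> g \<in> V \<and> U \<inter> V = {}"
    by (intro exI[of _ "(\<lambda>h. h a) -` U"] exI[of _ "(\<lambda>h. h a) -` V"])
       (auto simp: open_evaluation_vimage)
qed

lemma dual_groupD:
  assumes "\<xi> \<in> dual_group"
  shows "cmod (\<xi> b) = 1" "\<xi> (a + b) = \<xi> a * \<xi> b" "\<xi> 0 = 1" "\<xi> (- b) = cnj (\<xi> b)"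
    "\<xi> (a - b) = \<xi> a * cnj (\<xi> b)"
proof -
  have norm: "cmod (\<xi> b) = 1" and add: "\<xi> (a + b) = \<xi> a * \<xi> b" for a b
    using assms by (auto simp: dual_group_def)
  have "\<xi> 0 \<noteq> 0" using norm[of 0] by auto
  then have zero: "\<xi> 0 = 1" using add[of 0 0] by simp
  have "\<xi> b * cnj (\<xi> b) = 1" for b
    using norm[of b] by (simp flip: complex_norm_square)
  moreover have "\<xi> (- b) * \<xi> b = 1" for b using add[of "-b" b] zero by simp
  ultimately have minus: "\<xi> (- b) = cnj (\<xi> b)" for b
    by (metis mult.commute mult.assoc mult_1)
  show "cmod (\<xi> b) = 1" "\<xi> (a + b) = \<xi> a * \<xi> b" "\<xi> 0 = 1" "\<xi> (- b) = cnj (\<xi> b)"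
    "\<xi> (a - b) = \<xi> a * cnj (\<xi> b)"
    using norm add zero minus add[of a "-b"] by auto
qed

lemma compact_dual_group: "compact (dual_group :: ('b::ab_group_add \<Rightarrow> complex) set)"
proof -
  have "compactin (product_topology (\<lambda>_. euclidean) UNIV)
      (PiE UNIV (\<lambda>_. sphere 0 1) :: ('b \<Rightarrow> complex) set)"
    by (subst compactin_PiE) auto
  then have "compact (PiE UNIV (\<lambda>_. sphere 0 1) :: ('b \<Rightarrow> complex) set)"
    by (simp add: euclidean_product_topology)
  moreover have "closed {\<xi> :: 'b \<Rightarrow> complex. \<forall>a b. \<xi> (a + b) = \<xi> a * \<xi> b}"
    by (intro closed_Collect_all closed_Collect_eq continuous_intros continuous_on_product_coordinates)
  ultimately have "compact (PiE UNIV (\<lambda>_. sphere 0 1) \<inter>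
      {\<xi> :: 'b \<Rightarrow> complex. \<forall>a b. \<xi> (a + b) = \<xi> a * \<xi> b})"
    by (rule compact_Int_closed)
  also have "\<dots> = dual_group"
    by (auto simp: dual_group_def PiE_def Pi_def)
  finally show ?thesis .
qed

lemma dual_group_mult:
  "\<psi> \<in> dual_group \<Longrightarrow> \<xi> \<in> dual_group \<Longrightarrow> (\<lambda>b. \<psi> b * \<xi> b) \<in> dual_group"
  by (auto simp: dual_group_def norm_mult)

lemma dual_group_cnj: "\<psi> \<in> dual_group \<Longrightarrow> (\<lambda>b. cnj (\<psi> b)) \<in> dual_group"
  by (auto simp: dual_group_def)

section \<open>The characters form an orthonormal basis\<close>

text \<open>The elements \<open>b\<close> act on the dual as the characters \<open>\<xi> \<mapsto> \<xi> b\<close>. Their conjugates are used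
  as the basis, so that the \<open>b\<close>-th coefficient of \<open>f\<close> is \<open>\<integral> f(\<xi>) \<xi>(b) d\<mu>\<close>.\<close>

definition dual_basis :: "'b \<Rightarrow> ('b \<Rightarrow> complex) \<Rightarrow> complex" where
  "dual_basis b \<xi> = cnj (\<xi> b)"

lemma continuous_on_evaluation: "continuous_on A (\<lambda>\<xi> :: 'b \<Rightarrow> complex. \<xi> b)"
  by (rule continuous_on_subset[OF continuous_on_product_coordinates subset_UNIV])

locale haar_dual =
  fixes \<mu> :: "('b::ab_group_add \<Rightarrow> complex) measure"
  assumes haar: "normalized_haar \<mu>"
begin

lemma sets_haar: "sets \<mu> = sets (restrict_space borel dual_group)"
  using haar by (simp add: normalized_haar_def)

lemma space_haar: "space \<mu> = dual_group"
  using sets_eq_imp_space_eq[OF sets_haar] by (simp add: space_restrict_space)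

sublocale finite_measure \<mu>
  by standard (use haar space_haar in \<open>simp add: normalized_haar_def\<close>)

lemma measure_space_haar: "measure \<mu> dual_group = 1"
  using haar by (simp add: normalized_haar_def measure_def)

lemma continuous_on_imp_measurable_haar:
  fixes f :: "('b \<Rightarrow> complex) \<Rightarrow> 'c::topological_space"
  assumes "continuous_on dual_group f"
  shows "f \<in> borel_measurable \<mu>"
  using borel_measurable_continuous_on_restrict[OF assms]
  by (simp add: measurable_cong_sets[OF sets_haar refl])

lemma evaluation_measurable [measurable]: "(\<lambda>\<xi>. \<xi> b) \<in> borel_measurable \<mu>"
  by (intro continuous_on_imp_measurable_haar continuous_on_evaluation)

lemma closed_dual_sets:
  assumes "closed C" "C \<subseteq> dual_group"
  shows "C \<in> sets \<mu>"
  using assms by (auto simp: sets_haar sets_restrict_space intro!: image_eqI[of _ _ C])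

lemma open_Int_dual_sets:
  assumes "open V"
  shows "V \<inter> dual_group \<in> sets \<mu>"
  using assms by (auto simp: sets_haar sets_restrict_space intro!: image_eqI[of _ _ V])

lemma haar_integral_translate:
  assumes \<psi>: "\<psi> \<in> dual_group" and f: "f \<in> borel_measurable \<mu>"
  shows "(LINT \<xi>|\<mu>. f (\<lambda>b. \<psi> b * \<xi> b)) = (LINT \<xi>|\<mu>. f \<xi> :: complex)"
proof -
  define s where "s \<eta> \<xi> = (\<lambda>b. \<eta> b * \<xi> b)" for \<eta> \<xi> :: "'b \<Rightarrow> complex"
  have "continuous_on dual_group (s \<psi>)"
    unfolding s_def
    by (intro continuous_on_coordinatewise_then_product continuous_intros
        continuous_on_evaluation)
  then have "s \<psi> \<in> measurable \<mu> (restrict_space borel dual_group)"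
    using dual_group_mult[OF \<psi>]
    by (intro measurable_restrict_space2 continuous_on_imp_measurable_haar)
       (auto simp: space_haar s_def)
  then have meas: "s \<psi> \<in> measurable \<mu> \<mu>"
    by (simp add: measurable_cong_sets[OF refl sets_haar])
  have "emeasure (distr \<mu> \<mu> (s \<psi>)) A = emeasure \<mu> A" if A: "A \<in> sets \<mu>" for A
  proof -
    have inv: "\<psi> b * cnj (\<psi> b) = 1" for b
      using dual_groupD(1)[OF \<psi>, of b] by (simp flip: complex_norm_square)
    have inverse: "s \<psi> (s (\<lambda>b. cnj (\<psi> b)) \<xi>) = \<xi>" "s (\<lambda>b. cnj (\<psi> b)) (s \<psi> \<xi>) = \<xi>" for \<xi>
      using inv by (auto simp: s_def fun_eq_iff mult.assoc[symmetric] mult.commute[of "cnj _"])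
    have AK: "A \<subseteq> dual_group" using sets.sets_into_space[OF A] by (simp add: space_haar)
    \<comment> \<open>Invariance is about images, a push-forward about preimages: translate by the inverse.\<close>
    have "s \<psi> -` A \<inter> dual_group = s (\<lambda>b. cnj (\<psi> b)) ` A"
    proof (intro equalityI subsetI)
      fix \<xi> assume "\<xi> \<in> s \<psi> -` A \<inter> dual_group"
      then show "\<xi> \<in> s (\<lambda>b. cnj (\<psi> b)) ` A"
        by (intro image_eqI[of _ _ "s \<psi> \<xi>"]) (simp_all add: inverse)
    next
      fix \<xi> assume "\<xi> \<in> s (\<lambda>b. cnj (\<psi> b)) ` A"
      then show "\<xi> \<in> s \<psi> -` A \<inter> dual_group"
        using dual_group_mult[OF dual_group_cnj[OF \<psi>]] AK by (auto simp: inverse) (auto simp: s_def)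
    qed
    moreover have "emeasure \<mu> (s (\<lambda>b. cnj (\<psi> b)) ` A) = emeasure \<mu> A"
      unfolding s_def
      by (rule haar[unfolded normalized_haar_def, THEN conjunct2, THEN conjunct2, THEN conjunct1,
            THEN bspec, OF dual_group_cnj[OF \<psi>], THEN bspec, OF A])
    ultimately show ?thesis
      using emeasure_distr[OF meas A] by (simp add: space_haar)
  qed
  then have "distr \<mu> \<mu> (s \<psi>) = \<mu>"
    by (intro measure_eqI) auto
  then show ?thesis
    using integral_distr[OF meas f] by (simp add: s_def)
qed

text \<open>Translating by a character \<open>\<psi>\<close> multiplies the integral of \<open>\<xi> \<mapsto> \<xi> b\<close> by \<open>\<psi> b\<close>, so the
  integral vanishes as soon as some \<open>\<psi> b \<noteq> 1\<close>.\<close>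

lemma integral_evaluation: "(LINT \<xi>|\<mu>. \<xi> b) = (if b = 0 then 1 else 0)"
proof (cases "b = 0")
  case True
  have "(LINT \<xi>|\<mu>. \<xi> b) = (LINT \<xi>|\<mu>. 1)"
    by (rule Bochner_Integration.integral_cong) (auto simp: space_haar True dual_groupD(3))
  then show ?thesis using True measure_space_haar by (simp add: space_haar)
next
  case False
  then obtain \<psi> where \<psi>: "\<psi> \<in> dual_group" "\<psi> b \<noteq> 1"
    by (rule dual_group_separates_0)
  have "(LINT \<xi>|\<mu>. \<xi> b) = \<psi> b * (LINT \<xi>|\<mu>. \<xi> b)"
    using haar_integral_translate[OF \<psi>(1) evaluation_measurable, of b] by simp
  then show ?thesis using \<psi>(2) False by auto
qed

lemma evaluation_square_integrable: "square_integrable \<mu> (\<lambda>\<xi>. \<xi> b)"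
  unfolding square_integrable_def
  by (intro conjI evaluation_measurable integrable_const_bound[of _ 1])
     (auto simp: space_haar dual_groupD(1) intro!: AE_I2)

lemma dual_basis_measurable [measurable]: "dual_basis b \<in> borel_measurable \<mu>"
  unfolding dual_basis_def[abs_def]
  by (intro continuous_on_imp_measurable_haar continuous_intros
      continuous_on_evaluation)

sublocale orthonormal_family \<mu> dual_basis
proof
  show "square_integrable \<mu> (dual_basis b)" for b
    using evaluation_square_integrable[of b] by (simp add: square_integrable_def) (simp add: dual_basis_def)
  show "(LINT \<xi>|\<mu>. dual_basis a \<xi> * cnj (dual_basis b \<xi>)) = (if a = b then 1 else 0)" for a b
  proof -
    have "(LINT \<xi>|\<mu>. dual_basis a \<xi> * cnj (dual_basis b \<xi>)) = (LINT \<xi>|\<mu>. \<xi> (b - a))"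
      by (rule Bochner_Integration.integral_cong)
         (auto simp: space_haar dual_groupD(5) dual_basis_def)
    then show ?thesis by (simp add: integral_evaluation)
  qed
qed

lemma coef_dual_basis: "coef f b = (LINT \<xi>|\<mu>. f \<xi> * \<xi> b)"
  by (simp add: coef_def dual_basis_def)

text \<open>Completeness says that all annihilators vanish almost everywhere. The multipliers take the place
  of the trigonometric polynomials in the proof: closure under products is built into their
  definition.\<close>

definition annihilators :: "(('b \<Rightarrow> complex) \<Rightarrow> complex) set" where
  "annihilators = {g. square_integrable \<mu> g \<and> (\<forall>b. coef g b = 0)}"

definition multipliers :: "(('b \<Rightarrow> complex) \<Rightarrow> real) set" where
  "multipliers = {f. continuous_on dual_group f \<and>
     (\<forall>g\<in>annihilators. (\<lambda>\<xi>. of_real (f \<xi>) * g \<xi>) \<in> annihilators)}"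

lemma square_integrable_mult_continuous:
  fixes f :: "('b \<Rightarrow> complex) \<Rightarrow> complex"
  assumes f: "continuous_on dual_group f" and g: "square_integrable \<mu> g"
  shows "square_integrable \<mu> (\<lambda>\<xi>. f \<xi> * g \<xi>)"
proof -
  have [measurable]: "f \<in> borel_measurable \<mu>" "g \<in> borel_measurable \<mu>"
    using continuous_on_imp_measurable_haar[OF f] g by (auto simp: square_integrable_def)
  obtain B where B: "\<And>\<xi>. \<xi> \<in> dual_group \<Longrightarrow> cmod (f \<xi>) \<le> B"
    using compact_imp_bounded[OF compact_continuous_image[OF f compact_dual_group]]
    by (auto simp: bounded_iff)
  have "integrable \<mu> (\<lambda>\<xi>. (cmod (f \<xi> * g \<xi>))\<^sup>2)"
    by (rule Bochner_Integration.integrable_bound[where f = "\<lambda>\<xi>. B\<^sup>2 * (cmod (g \<xi>))\<^sup>2"])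
       (use g B in \<open>auto simp: square_integrable_def space_haar norm_mult power_mult_distrib
          intro!: AE_I2 mult_right_mono power_mono\<close>)
  then show ?thesis by (simp add: square_integrable_def)
qed

lemma annihilators_add:
  assumes "g \<in> annihilators" "h \<in> annihilators"
  shows "(\<lambda>\<xi>. g \<xi> + h \<xi>) \<in> annihilators"
proof -
  have "coef (\<lambda>\<xi>. g \<xi> + h \<xi>) b = coef g b + coef h b" for b
    using integrable_mult_cnj[OF _ square_integrable_e, of g b]
      integrable_mult_cnj[OF _ square_integrable_e, of h b] assms
    by (simp add: annihilators_def coef_def distrib_right)
  then show ?thesis using assms by (auto simp: annihilators_def)
qed

lemma annihilators_cmult:
  assumes "g \<in> annihilators"
  shows "(\<lambda>\<xi>. c * g \<xi>) \<in> annihilators"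
  using assms by (auto simp: annihilators_def coef_def mult.assoc)

text \<open>Multiplication by a character only shifts the coefficients.\<close>

lemma annihilators_mult_evaluation:
  assumes "g \<in> annihilators"
  shows "(\<lambda>\<xi>. \<xi> a * g \<xi>) \<in> annihilators"
proof -
  have "coef (\<lambda>\<xi>. \<xi> a * g \<xi>) b = coef g (a + b)" for b
    unfolding coef_dual_basis
    by (rule Bochner_Integration.integral_cong) (auto simp: space_haar dual_groupD(2))
  moreover have "square_integrable \<mu> (\<lambda>\<xi>. \<xi> a * g \<xi>)"
    using assms by (intro square_integrable_mult_continuous
        continuous_on_evaluation) (auto simp: annihilators_def)
  ultimately show ?thesis using assms by (auto simp: annihilators_def)
qed

lemma annihilators_cong:
  assumes "g \<in> annihilators" "\<And>\<xi>. \<xi> \<in> dual_group \<Longrightarrow> h \<xi> = g \<xi>"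
  shows "h \<in> annihilators"
proof -
  have "square_integrable \<mu> h = square_integrable \<mu> g"
    unfolding square_integrable_def using assms(2)
    by (intro arg_cong2[where f = "(\<and>)"] measurable_cong Bochner_Integration.integrable_cong)
       (auto simp: space_haar)
  moreover have "coef h b = coef g b" for b
    unfolding coef_def using assms(2)
    by (intro Bochner_Integration.integral_cong) (auto simp: space_haar)
  ultimately show ?thesis using assms(1) by (auto simp: annihilators_def)
qed

lemma Re_Im_evaluation_multipliers:
  "(\<lambda>\<xi>. Re (\<xi> b)) \<in> multipliers" "(\<lambda>\<xi>. Im (\<xi> b)) \<in> multipliers"
proof -
  have *: "(\<lambda>\<xi>. c * (\<xi> b * g \<xi>) + d * (\<xi> (- b) * g \<xi>)) \<in> annihilators" if "g \<in> annihilators" for g c d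
    by (intro annihilators_add annihilators_cmult annihilators_mult_evaluation that)
  have re: "of_real (Re z) = (1/2) * z + (1/2) * cnj z"
    and im: "of_real (Im z) = (-\<i>/2) * z + (\<i>/2) * cnj z" for z
    by (auto simp: complex_eq_iff)
  have "(\<lambda>\<xi>. of_real (Re (\<xi> b)) * g \<xi>) \<in> annihilators" if "g \<in> annihilators" for g
    by (rule annihilators_cong[OF *[OF that, of "1/2" "1/2"]])
       (simp only: re dual_groupD(4) distrib_right mult.assoc)
  moreover have "(\<lambda>\<xi>. of_real (Im (\<xi> b)) * g \<xi>) \<in> annihilators" if "g \<in> annihilators" for g
    by (rule annihilators_cong[OF *[OF that, of "-\<i>/2" "\<i>/2"]])
       (simp only: im dual_groupD(4) distrib_right mult.assoc)
  ultimately show "(\<lambda>\<xi>. Re (\<xi> b)) \<in> multipliers" "(\<lambda>\<xi>. Im (\<xi> b)) \<in> multipliers"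
    by (auto simp: multipliers_def intro!: continuous_intros
        continuous_on_evaluation)
qed

text \<open>The real and imaginary parts of the characters are multipliers and separate points, so the
  separation lemma behind the Stone--Weierstrass theorem becomes available.\<close>

lemma function_ring_multipliers: "function_ring_on multipliers dual_group"
proof
  show "compact (dual_group :: ('b \<Rightarrow> complex) set)" by (rule compact_dual_group)
  show "continuous_on dual_group f" if "f \<in> multipliers" for f
    using that by (simp add: multipliers_def)
  show "(\<lambda>\<xi>. f \<xi> + g \<xi>) \<in> multipliers" if "f \<in> multipliers" "g \<in> multipliers" for f g
    using that annihilators_add
    by (auto simp: multipliers_def distrib_right intro!: continuous_intros)
  show "(\<lambda>\<xi>. f \<xi> * g \<xi>) \<in> multipliers" if "f \<in> multipliers" "g \<in> multipliers" for f g
    using that by (auto simp: multipliers_def mult.assoc intro!: continuous_intros)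
  show "(\<lambda>_. c) \<in> multipliers" for c
    using annihilators_cmult by (auto simp: multipliers_def)
  show "\<exists>f\<in>multipliers. f \<xi> \<noteq> f \<psi>" if neq: "\<xi> \<noteq> \<psi>" for \<xi> \<psi>
  proof -
    obtain b where "\<xi> b \<noteq> \<psi> b" using neq by (auto simp: fun_eq_iff)
    then have "Re (\<xi> b) \<noteq> Re (\<psi> b) \<or> Im (\<xi> b) \<noteq> Im (\<psi> b)" by (simp add: complex_eq_iff)
    then show ?thesis
      by (elim disjE) (rule bexI[of _ "\<lambda>\<xi>. Re (\<xi> b)"] bexI[of _ "\<lambda>\<xi>. Im (\<xi> b)"],
          assumption, rule Re_Im_evaluation_multipliers)+
  qed
qed

text \<open>Regularity squeezes \<open>A\<close> between a compact \<open>C\<close> and an open \<open>V\<close> of nearly equal measure, and a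
  multiplier nearly \<open>1\<close> on \<open>C\<close> and nearly \<open>0\<close> off \<open>V\<close> approximates the indicator of \<open>A\<close>.\<close>

lemma multiplier_approximates_indicator:
  assumes A: "A \<in> sets \<mu>" and "0 < \<epsilon>" "\<epsilon> < 1"
  obtains f where "f \<in> multipliers"
    "(LINT \<xi>|\<mu>. (indicator A \<xi> - f \<xi>)\<^sup>2) \<le> 3 * \<epsilon>"
proof -
  let ?K = "dual_group :: ('b \<Rightarrow> complex) set"
  have AK: "A \<subseteq> ?K" using sets.sets_into_space[OF A] by (simp add: space_haar)
  have outer: "emeasure \<mu> A = (INF V\<in>{V. open V \<and> A \<subseteq> V}. emeasure \<mu> (V \<inter> ?K))"
    and inner: "emeasure \<mu> A = (SUP C\<in>{C. compact C \<and> C \<subseteq> A}. emeasure \<mu> C)"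
    using haar A by (auto simp: normalized_haar_def)
  have "emeasure \<mu> A < emeasure \<mu> A + \<epsilon>"
    using \<open>0 < \<epsilon>\<close>
    by (simp add: emeasure_eq_measure ennreal_less_iff flip: ennreal_plus)
  then obtain V where V: "open V" "A \<subseteq> V" "emeasure \<mu> (V \<inter> ?K) < emeasure \<mu> A + \<epsilon>"
    by (subst (asm) outer) (auto simp: INF_less_iff)
  obtain C where C: "compact C" "C \<subseteq> A" "emeasure \<mu> A < emeasure \<mu> C + \<epsilon>"
  proof (cases "emeasure \<mu> A = 0")
    case True
    then show ?thesis using that[of "{}"] \<open>0 < \<epsilon>\<close> by simp
  next
    case False
    then have "emeasure \<mu> A - \<epsilon> < emeasure \<mu> A"
      using \<open>0 < \<epsilon>\<close> by (intro ennreal_between) (auto simp: zero_less_iff_neq_zero emeasure_eq_measure)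
    then obtain C where "compact C" "C \<subseteq> A" "emeasure \<mu> A - \<epsilon> < emeasure \<mu> C"
      by (subst (asm) (2) inner) (auto simp: less_SUP_iff)
    moreover have "emeasure \<mu> A < emeasure \<mu> C + \<epsilon>"
    proof (rule ccontr)
      assume "\<not> ?thesis"
      then have "(emeasure \<mu> C + \<epsilon>) - \<epsilon> \<le> emeasure \<mu> A - \<epsilon>"
        by (intro ennreal_minus_mono) auto
      then show False
        using \<open>emeasure \<mu> A - \<epsilon> < emeasure \<mu> C\<close>
        by (simp add: ennreal_add_diff_cancel_right)
    qed
    ultimately show ?thesis using that by blast
  qed
  have [measurable]: "A \<in> sets \<mu>" "C \<in> sets \<mu>" "V \<inter> ?K \<in> sets \<mu>"
    using A C AK V by (auto intro!: closed_dual_sets open_Int_dual_sets compact_imp_closed)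
  define D where "D = V \<inter> ?K - C"
  have [measurable]: "D \<in> sets \<mu>" by (simp add: D_def)
  have "measure \<mu> (V \<inter> ?K) < measure \<mu> A + \<epsilon>" "measure \<mu> A < measure \<mu> C + \<epsilon>"
    using V(3) C(3) \<open>0 < \<epsilon>\<close>
    by (simp_all add: emeasure_eq_measure ennreal_less_iff flip: ennreal_plus)
  moreover have "measure \<mu> D = measure \<mu> (V \<inter> ?K) - measure \<mu> C"
    unfolding D_def using C V AK by (intro finite_measure_Diff) auto
  ultimately have D: "measure \<mu> D \<le> 2 * \<epsilon>" by simp
  have "closed (?K - V)"
    using compact_imp_closed[OF compact_dual_group] V(1) by (rule closed_Diff)
  then obtain f where f: "f \<in> multipliers" "f ` ?K \<subseteq> {0..1}"
      "\<And>\<xi>. \<xi> \<in> ?K - V \<Longrightarrow> f \<xi> < \<epsilon>" "\<And>\<xi>. \<xi> \<in> C \<Longrightarrow> f \<xi> > 1 - \<epsilon>"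
    using function_ring_on.two[OF function_ring_multipliers _ _ compact_imp_closed[OF C(1)],
        of "?K - V" \<epsilon>] C(2) V(2) AK assms(2,3)
    by auto blast
  have fmeas [measurable]: "f \<in> borel_measurable \<mu>"
    using f(1) by (auto simp: multipliers_def intro: continuous_on_imp_measurable_haar)
  \<comment> \<open>Both functions take values in \<open>[0, 1]\<close>, so the square is bounded by the absolute value.\<close>
  have pt: "(indicator A \<xi> - f \<xi>)\<^sup>2 \<le> \<epsilon> + indicator D \<xi>" if \<xi>: "\<xi> \<in> ?K" for \<xi>
  proof -
    have f01: "0 \<le> f \<xi>" "f \<xi> \<le> 1" using f(2) \<xi> by auto
    have "\<bar>indicator A \<xi> - f \<xi>\<bar> \<le> \<epsilon> + indicator D \<xi>"
      using f01 f(3)[of \<xi>] f(4)[of \<xi>] \<xi> C(2) V(2) \<open>0 < \<epsilon>\<close>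
      by (auto simp: D_def indicator_def)
    moreover have "\<bar>indicator A \<xi> - f \<xi>\<bar> \<le> 1"
      using f01 by (auto simp: indicator_def)
    then have "\<bar>indicator A \<xi> - f \<xi>\<bar> * \<bar>indicator A \<xi> - f \<xi>\<bar> \<le> \<bar>indicator A \<xi> - f \<xi>\<bar> * 1"
      by (intro mult_left_mono) auto
    ultimately show ?thesis by (simp add: power2_eq_square)
  qed
  have DK: "D \<inter> ?K = D" by (auto simp: D_def)
  have intD: "integrable \<mu> (indicator D :: _ \<Rightarrow> real)"
    by (rule integrable_real_indicator) (simp_all add: emeasure_eq_measure)
  then have int: "integrable \<mu> (\<lambda>\<xi>. \<epsilon> + indicator D \<xi>)"
    by (intro Bochner_Integration.integrable_add integrable_const)
  have "(LINT \<xi>|\<mu>. (indicator A \<xi> - f \<xi>)\<^sup>2) \<le> (LINT \<xi>|\<mu>. \<epsilon> + indicator D \<xi>)"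
  proof (rule integral_mono)
    show "integrable \<mu> (\<lambda>\<xi>. (indicator A \<xi> - f \<xi>)\<^sup>2)"
      by (rule Bochner_Integration.integrable_bound[OF int])
         (use pt \<open>0 < \<epsilon>\<close> in \<open>auto simp: space_haar intro!: AE_I2\<close>)
  qed (rule int, use pt space_haar in simp)
  also have "\<dots> = \<epsilon> + measure \<mu> D"
    using measure_space_haar intD DK
    by (subst Bochner_Integration.integral_add) (auto simp: space_haar)
  finally show ?thesis using that f(1) D by simp
qed

text \<open>For a multiplier \<open>f\<close> the integral of \<open>f g\<close> is the coefficient at \<open>0\<close> of an annihilator, hence
  zero; letting \<open>f\<close> approach the indicator of \<open>A\<close> in \<open>L\<^sup>2\<close> gives the claim.\<close>

lemma annihilator_integral_zero:
  assumes g: "g \<in> annihilators" and A: "A \<in> sets \<mu>"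
  shows "(LINT \<xi>|\<mu>. indicator A \<xi> * g \<xi>) = 0"
proof -
  let ?I = "cmod (LINT \<xi>|\<mu>. indicator A \<xi> * g \<xi>)"
  define B where "B = (LINT \<xi>|\<mu>. (cmod (g \<xi>))\<^sup>2)"
  have gsi: "square_integrable \<mu> g" using g by (simp add: annihilators_def)
  have [measurable]: "A \<in> sets \<mu>" by (rule A)
  have "B \<ge> 0" by (simp add: B_def)
  have bound: "?I\<^sup>2 \<le> 3 * \<epsilon> * B" if \<epsilon>: "0 < \<epsilon>" "\<epsilon> < 1" for \<epsilon>
  proof -
    obtain f where f: "f \<in> multipliers" "(LINT \<xi>|\<mu>. (indicator A \<xi> - f \<xi>)\<^sup>2) \<le> 3 * \<epsilon>"
      using multiplier_approximates_indicator[OF A \<epsilon>] by blast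
    have fcont: "continuous_on dual_group (\<lambda>\<xi>. complex_of_real (f \<xi>))"
      using f(1) by (auto simp: multipliers_def intro!: continuous_intros)
    have one: "square_integrable \<mu> (\<lambda>\<xi>. 1)" by (simp add: square_integrable_def)
    have ind: "square_integrable \<mu> (\<lambda>\<xi>. indicator A \<xi> :: complex)"
      by (auto simp: square_integrable_def intro!: integrable_const_bound[of _ 1] AE_I2
          split: split_indicator)
    have fsi: "square_integrable \<mu> (\<lambda>\<xi>. of_real (f \<xi>))"
      using square_integrable_mult_continuous[OF fcont one] by simp
    have gc: "square_integrable \<mu> (\<lambda>\<xi>. cnj (g \<xi>))"
      using gsi by (auto simp: square_integrable_def
          intro!: borel_measurable_continuous_on[where f = cnj] continuous_intros)
    let ?d = "\<lambda>\<xi>. indicator A \<xi> - complex_of_real (f \<xi>)"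
    have fg: "(\<lambda>\<xi>. of_real (f \<xi>) * g \<xi>) \<in> annihilators"
      using f(1) g by (simp add: multipliers_def)
    have "(LINT \<xi>|\<mu>. of_real (f \<xi>) * g \<xi>) = coef (\<lambda>\<xi>. of_real (f \<xi>) * g \<xi>) 0"
      unfolding coef_dual_basis
      by (rule Bochner_Integration.integral_cong) (auto simp: space_haar dual_groupD(3))
    also have "\<dots> = 0" using fg by (simp add: annihilators_def)
    finally have "(LINT \<xi>|\<mu>. indicator A \<xi> * g \<xi>) = (LINT \<xi>|\<mu>. ?d \<xi> * cnj (cnj (g \<xi>)))"
      using integrable_mult_cnj[OF ind gc] integrable_mult_cnj[OF fsi gc]
      by (simp add: left_diff_distrib)
    then have "?I\<^sup>2 \<le> (LINT \<xi>|\<mu>. (cmod (?d \<xi>))\<^sup>2) * (LINT \<xi>|\<mu>. (cmod (cnj (g \<xi>)))\<^sup>2)"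
      using Cauchy_Schwarz_square_integrable[OF square_integrable_diff[OF ind fsi] gc] by simp
    also have "(LINT \<xi>|\<mu>. (cmod (?d \<xi>))\<^sup>2) = (LINT \<xi>|\<mu>. (indicator A \<xi> - f \<xi>)\<^sup>2)"
      by (rule Bochner_Integration.integral_cong)
         (auto simp: cmod_power2 split: split_indicator)
    also have "\<dots> * (LINT \<xi>|\<mu>. (cmod (cnj (g \<xi>)))\<^sup>2) \<le> 3 * \<epsilon> * B"
      using f(2) \<open>B \<ge> 0\<close> by (simp add: B_def mult_right_mono)
    finally show ?thesis .
  qed
  have "?I\<^sup>2 \<le> 0 + e" if "e > 0" for e
  proof -
    define \<epsilon> where "\<epsilon> = min (1/2) (e / (3 * B + 1))"
    have "0 < \<epsilon>" "\<epsilon> < 1" using \<open>e > 0\<close> \<open>B \<ge> 0\<close> by (auto simp: \<epsilon>_def)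
    have "\<epsilon> * (3 * B + 1) \<le> e"
      using mult_right_mono[of \<epsilon> "e / (3 * B + 1)" "3 * B + 1"] \<open>B \<ge> 0\<close>
      by (simp add: \<epsilon>_def)
    then show ?thesis using bound[OF \<open>0 < \<epsilon>\<close> \<open>\<epsilon> < 1\<close>] \<open>0 < \<epsilon>\<close> by (simp add: algebra_simps)
  qed
  then have "?I\<^sup>2 \<le> 0" by (rule field_le_epsilon)
  then show ?thesis by simp
qed

sublocale orthonormal_basis \<mu> dual_basis
proof
  fix g assume g: "square_integrable \<mu> g" "\<And>b. coef g b = 0"
  then have "g \<in> annihilators" by (simp add: annihilators_def)
  have "integrable \<mu> (\<lambda>\<xi>. g \<xi> * cnj 1)"
    by (rule integrable_mult_cnj[OF g(1)]) (simp add: square_integrable_def)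
  then have "integrable \<mu> g" by simp
  then show "AE \<xi> in \<mu>. g \<xi> = 0"
  proof (rule density_zero)
    fix A assume "A \<in> sets \<mu>"
    then show "set_lebesgue_integral \<mu> A g = 0"
      using annihilator_integral_zero[OF \<open>g \<in> annihilators\<close>]
      by (simp add: set_lebesgue_integral_def scaleR_conv_of_real of_real_indicator)
  qed
qed

end

section \<open>The semidirect product\<close>

lemma aut_pow_0 [simp]: "aut_pow \<alpha> 0 = id"
  by (simp add: aut_pow_def)

lemma aut_pow_succ:
  assumes "bij \<alpha>"
  shows "aut_pow \<alpha> (j + 1) b = \<alpha> (aut_pow \<alpha> j b)"
proof (cases "0 \<le> j")
  case True
  then show ?thesis by (simp add: aut_pow_def nat_add_distrib)
next
  case False
  then obtain m where m: "j = - int (Suc m)"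
    by (cases j rule: int_cases) auto
  have "aut_pow \<alpha> (j + 1) = inv_into UNIV \<alpha> ^^ m"
    by (auto simp: m aut_pow_def)
  moreover have "aut_pow \<alpha> j = inv_into UNIV \<alpha> ^^ Suc m"
    unfolding aut_pow_def m by (simp del: funpow.simps of_nat_Suc)
  ultimately show ?thesis
    using assms by (simp add: bij_is_surj surj_f_inv_f)
qed

lemma aut_pow_add:
  assumes "bij \<alpha>"
  shows "aut_pow \<alpha> (j + k) b = aut_pow \<alpha> j (aut_pow \<alpha> k b)"
proof (induction j rule: int_induct[of _ 0])
  case (step1 i)
  have "aut_pow \<alpha> (i + 1 + k) b = aut_pow \<alpha> (i + k + 1) b" by (simp add: ac_simps)
  also have "\<dots> = aut_pow \<alpha> (i + 1) (aut_pow \<alpha> k b)"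
    unfolding aut_pow_succ[OF assms] step1(2) ..
  finally show ?case .
next
  case (step2 i)
  have "\<alpha> (aut_pow \<alpha> (i - 1 + k) b) = \<alpha> (aut_pow \<alpha> (i - 1) (aut_pow \<alpha> k b))"
    using step2 aut_pow_succ[OF assms, of "i - 1 + k"] aut_pow_succ[OF assms, of "i - 1"]
    by (simp add: algebra_simps)
  then show ?case using assms by (simp add: bij_is_inj inj_eq)
qed simp

lemma aut_pow_hom:
  assumes \<alpha>: "bij \<alpha>" "\<And>a b. \<alpha> (a + b) = \<alpha> a + \<alpha> b"
  shows "aut_pow \<alpha> j (a + b) = aut_pow \<alpha> j a + aut_pow \<alpha> j b"
proof (induction j rule: int_induct[of _ 0])
  case (step1 i)
  then show ?case by (simp add: aut_pow_succ \<alpha>)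
next
  case (step2 i)
  have "\<alpha> (aut_pow \<alpha> (i - 1) (a + b)) = \<alpha> (aut_pow \<alpha> (i - 1) a + aut_pow \<alpha> (i - 1) b)"
    using step2 aut_pow_succ[OF \<alpha>(1), of "i - 1"] by (simp add: \<alpha>(2))
  then show ?case using \<alpha>(1) by (simp add: bij_is_inj inj_eq)
qed simp

lemma group_semidirect:
  assumes \<alpha>: "bij \<alpha>" "\<And>a b. \<alpha> (a + b) = \<alpha> a + \<alpha> b"
  shows "group (semidirect \<alpha>)"
proof (rule groupI)
  fix x y z assume "x \<in> carrier (semidirect \<alpha>)"
  show "x \<otimes>\<^bsub>semidirect \<alpha>\<^esub> y \<otimes>\<^bsub>semidirect \<alpha>\<^esub> z = x \<otimes>\<^bsub>semidirect \<alpha>\<^esub> (y \<otimes>\<^bsub>semidirect \<alpha>\<^esub> z)"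
    by (cases x; cases y; cases z)
       (simp add: semidirect_def aut_pow_add[OF \<alpha>(1)] aut_pow_hom[OF \<alpha>] add.assoc)
  show "\<exists>y\<in>carrier (semidirect \<alpha>). y \<otimes>\<^bsub>semidirect \<alpha>\<^esub> x = \<one>\<^bsub>semidirect \<alpha>\<^esub>"
    by (cases x) (auto simp: semidirect_def intro!: exI[of _ "- fst x"] exI[of _ "- aut_pow \<alpha> (- fst x) (snd x)"])
  have "aut_pow \<alpha> j 0 = 0" for j
    using aut_pow_hom[OF \<alpha>, of j 0 0] by simp
  then show "\<one>\<^bsub>semidirect \<alpha>\<^esub> \<otimes>\<^bsub>semidirect \<alpha>\<^esub> x = x"
    by (cases x) (simp add: semidirect_def)
qed (simp_all add: semidirect_def)

section \<open>The right regular representation\<close>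

lemma square_summable_add:
  assumes "(\<lambda>i. (cmod (u i))\<^sup>2) summable_on A" "(\<lambda>i. (cmod (v i))\<^sup>2) summable_on A"
  shows "(\<lambda>i. (cmod (u i + v i))\<^sup>2) summable_on A"
  by (rule summable_on_comparison_test[where f = "\<lambda>i. 2 * (cmod (u i))\<^sup>2 + 2 * (cmod (v i))\<^sup>2"])
     (auto intro!: summable_on_add summable_on_cmult_right assms cmod_add_square_le)

lemma square_summable_cmult:
  assumes "(\<lambda>i. (cmod (u i))\<^sup>2) summable_on A"
  shows "(\<lambda>i. (cmod (c * u i))\<^sup>2) summable_on A"
  unfolding norm_mult power_mult_distrib by (intro summable_on_cmult_right assms)

lemma l2_space_simps [simp]:
  "F \<in> vecs l2_space \<longleftrightarrow> (\<lambda>g. (cmod (F g))\<^sup>2) summable_on UNIV"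
  "vadd l2_space F F' = (\<lambda>g. F g + F' g)"
  "vscale l2_space c F = (\<lambda>g. c * F g)"
  "vinner l2_space F F' = (\<Sum>\<^sub>\<infinity>g. F g * cnj (F' g))"
  by (simp_all add: l2_space_def)

lemma right_translation_bij:
  assumes G: "group G" "carrier G = UNIV"
  shows "bij (\<lambda>x. x \<otimes>\<^bsub>G\<^esub> g)"
proof -
  interpret group G by fact
  show ?thesis
    by (rule bij_betw_byWitness[where f' = "\<lambda>x. x \<otimes>\<^bsub>G\<^esub> inv\<^bsub>G\<^esub> g"])
       (auto simp: G(2) m_assoc)
qed

lemma unitary_rep_right_regular:
  assumes G: "group G" "carrier G = UNIV"
  shows "unitary_rep G l2_space (right_regular G)"
proof -
  interpret group G by fact
  have l2: "(\<lambda>x. (cmod (F (x \<otimes>\<^bsub>G\<^esub> g)))\<^sup>2) summable_on UNIV \<longleftrightarrow> (\<lambda>x. (cmod (F x))\<^sup>2) summable_on UNIV" for F g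
    using summable_on_reindex_bij_betw[OF right_translation_bij[OF G]] .
  have comp: "right_regular G (g \<otimes>\<^bsub>G\<^esub> h) F = right_regular G g (right_regular G h F)" for g h F
    by (auto simp: right_regular_def G(2) m_assoc)
  have one: "right_regular G \<one>\<^bsub>G\<^esub> F = F" for F
    by (auto simp: right_regular_def G(2))
  have "unitary_map l2_space l2_space (right_regular G g)" for g
    unfolding unitary_map_def
  proof (intro conjI ballI allI)
    have inverse: "right_regular G g (right_regular G (inv\<^bsub>G\<^esub> g) F) = F"
      "right_regular G (inv\<^bsub>G\<^esub> g) (right_regular G g F) = F" for F
      by (simp_all add: comp[symmetric] one G(2))
    have closed: "right_regular G h ` vecs l2_space \<subseteq> vecs l2_space" for h
      by (auto simp: right_regular_def l2)
    show "bij_betw (right_regular G g) (vecs l2_space) (vecs l2_space)"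
      by (rule bij_betw_byWitness[where f' = "right_regular G (inv\<^bsub>G\<^esub> g)"])
         (use closed in \<open>auto simp: inverse\<close>)
    show "vinner l2_space (right_regular G g F) (right_regular G g F') = vinner l2_space F F'" for F F'
      using infsum_reindex_bij_betw[OF right_translation_bij[OF G], where f = "\<lambda>x. F x * cnj (F' x)"]
      by (simp add: right_regular_def)
  qed (simp_all add: right_regular_def)
  then show ?thesis using G(1) comp by (simp add: unitary_rep_def)
qed

text \<open>Transporting the representation along \<open>T\<close> avoids a separate verification that the action
  defined on classes of fields is a unitary representation.\<close>

lemma unitarily_equivalent_transport:
  assumes \<pi>: "unitary_rep G V \<pi>" and T: "unitary_map V W T"
    and add: "\<And>u v. u \<in> vecs V \<Longrightarrow> v \<in> vecs V \<Longrightarrow> vadd V u v \<in> vecs V"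
    and scale: "\<And>c v. v \<in> vecs V \<Longrightarrow> vscale V c v \<in> vecs V"
    and intertwine: "\<And>g v. g \<in> carrier G \<Longrightarrow> v \<in> vecs V \<Longrightarrow> T (\<pi> g v) = \<rho> g (T v)"
  shows "unitarily_equivalent G V \<pi> W \<rho>"
proof -
  have bij: "bij_betw T (vecs V) (vecs W)" using T by (simp add: unitary_map_def)
  then have W: "vecs W = T ` vecs V" by (simp add: bij_betw_def)
  have closed: "\<pi> g v \<in> vecs V" if "g \<in> carrier G" "v \<in> vecs V" for g v
  proof -
    have "bij_betw (\<pi> g) (vecs V) (vecs V)"
      using \<pi> that(1) by (simp add: unitary_rep_def unitary_map_def)
    then show ?thesis using that(2) by (rule bij_betw_apply)
  qed
  have "unitary_map W W (\<rho> g)" if g: "g \<in> carrier G" for g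
  proof -
    have \<pi>g: "unitary_map V V (\<pi> g)" using \<pi> g by (simp add: unitary_rep_def)
    have "bij_betw (T \<circ> \<pi> g \<circ> inv_into (vecs V) T) (vecs W) (vecs W)"
      using bij \<pi>g by (auto simp: unitary_map_def intro!: bij_betw_trans bij_betw_inv_into)
    moreover have "\<rho> g w = (T \<circ> \<pi> g \<circ> inv_into (vecs V) T) w" if "w \<in> vecs W" for w
      using intertwine[OF g, of "inv_into (vecs V) T w"] that W
      by (simp add: f_inv_into_f inv_into_into)
    ultimately have "bij_betw (\<rho> g) (vecs W) (vecs W)"
      by (subst bij_betw_cong) auto
    moreover have "\<rho> g (vadd W (T u) (T v)) = vadd W (\<rho> g (T u)) (\<rho> g (T v))"
      "vinner W (\<rho> g (T u)) (\<rho> g (T v)) = vinner W (T u) (T v)"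
      "\<rho> g (vscale W c (T v)) = vscale W c (\<rho> g (T v))"
      if "u \<in> vecs V" "v \<in> vecs V" for u v c
    proof -
      have "vadd W (T x) (T y) = T (vadd V x y)" "vscale W c (T x) = T (vscale V c x)"
        "vinner W (T x) (T y) = vinner V x y" if "x \<in> vecs V" "y \<in> vecs V" for x y
        using T that by (simp_all add: unitary_map_def)
      then show "\<rho> g (vadd W (T u) (T v)) = vadd W (\<rho> g (T u)) (\<rho> g (T v))"
        "vinner W (\<rho> g (T u)) (\<rho> g (T v)) = vinner W (T u) (T v)"
        "\<rho> g (vscale W c (T v)) = vscale W c (\<rho> g (T v))"
        using that \<pi>g by (simp_all add: unitary_map_def closed add scale g flip: intertwine)
    qed
    ultimately show ?thesis unfolding unitary_map_def W by simp
  qed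
  moreover have "\<rho> (g \<otimes>\<^bsub>G\<^esub> h) w = \<rho> g (\<rho> h w)" if "g \<in> carrier G" "h \<in> carrier G" "w \<in> vecs W" for g h w
  proof -
    have "group G" using \<pi> by (simp add: unitary_rep_def)
    then have "g \<otimes>\<^bsub>G\<^esub> h \<in> carrier G" using that by (simp add: group.is_monoid monoid.m_closed)
    then show ?thesis
      using that closed \<pi> unfolding W unitary_rep_def by (auto simp flip: intertwine)
  qed
  ultimately have "unitary_rep G W \<rho>" using \<pi> by (simp add: unitary_rep_def)
  then show ?thesis using \<pi> T intertwine by (auto simp: unitarily_equivalent_def)
qed

section \<open>Square integrable fields over the dual group\<close>

lemma integral_infsum_int:
  fixes f :: "int \<Rightarrow> 'a \<Rightarrow> real"
  assumes int: "\<And>j. integrable M (f j)" and pos: "\<And>j x. 0 \<le> f j x"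
    and pointwise: "\<And>x. x \<in> space M \<Longrightarrow> (\<lambda>j. f j x) summable_on UNIV"
    and sum: "(\<lambda>j. LINT x|M. f j x) summable_on UNIV"
  shows "integrable M (\<lambda>x. \<Sum>\<^sub>\<infinity>j. f j x)"
    and "((\<lambda>j. LINT x|M. f j x) has_sum (LINT x|M. (\<Sum>\<^sub>\<infinity>j. f j x))) UNIV"
proof -
  have summable: "summable (\<lambda>n. f (int_decode n) x)" if "x \<in> space M" for x
    using pointwise[OF that] summable_on_reindex_bij_betw[OF bij_int_decode, of "\<lambda>j. f j x"]
    by (simp add: summable_on_UNIV_nonneg_real_iff pos)
  have eq: "(\<Sum>\<^sub>\<infinity>j. f j x) = (\<Sum>n. f (int_decode n) x)" if "x \<in> space M" for x
    using sums_nonneg_imp_has_sum[OF summable_sums[OF summable[OF that]]] pos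
      infsum_reindex_bij_betw[OF bij_int_decode, of "\<lambda>j. f j x"]
    by (simp add: infsumI)
  have sum': "summable (\<lambda>n. LINT x|M. f (int_decode n) x)"
    using sum summable_on_reindex_bij_betw[OF bij_int_decode, of "\<lambda>j. LINT x|M. f j x"]
    by (simp add: summable_on_UNIV_nonneg_real_iff pos)
  have AE: "AE x in M. summable (\<lambda>n. norm (f (int_decode n) x))"
    using summable by (intro AE_I2) (simp add: pos)
  have norm: "summable (\<lambda>n. LINT x|M. norm (f (int_decode n) x))"
    using sum' by (simp add: pos)
  have "integrable M (\<lambda>x. \<Sum>n. f (int_decode n) x)"
    by (rule integrable_suminf[OF int AE norm])
  then show "integrable M (\<lambda>x. \<Sum>\<^sub>\<infinity>j. f j x)"
    by (subst Bochner_Integration.integrable_cong[OF refl eq]) auto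
  have "(\<lambda>n. LINT x|M. f (int_decode n) x) sums (LINT x|M. (\<Sum>n. f (int_decode n) x))"
    by (rule sums_integral[OF int AE norm])
  also have "(LINT x|M. (\<Sum>n. f (int_decode n) x)) = (LINT x|M. (\<Sum>\<^sub>\<infinity>j. f j x))"
    by (rule Bochner_Integration.integral_cong) (simp_all add: eq)
  finally have "((\<lambda>n. LINT x|M. f (int_decode n) x) has_sum (LINT x|M. (\<Sum>\<^sub>\<infinity>j. f j x))) UNIV"
    by (rule sums_nonneg_imp_has_sum) (simp add: pos)
  then show "((\<lambda>j. LINT x|M. f j x) has_sum (LINT x|M. (\<Sum>\<^sub>\<infinity>j. f j x))) UNIV"
    by (rule has_sum_reindex_bij_betw[OF bij_int_decode, THEN iffD1])
qed

text \<open>For nonnegative terms, integrability of the sum bounds the sums of the integrals, so it can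
  replace the summability of the integrals as a hypothesis.\<close>

lemma integral_infsum_int_of_integrable:
  fixes f :: "int \<Rightarrow> 'a \<Rightarrow> real"
  assumes meas: "\<And>j. f j \<in> borel_measurable M" and pos: "\<And>j x. 0 \<le> f j x"
    and pointwise: "\<And>x. x \<in> space M \<Longrightarrow> (\<lambda>j. f j x) summable_on UNIV"
    and int: "integrable M (\<lambda>x. \<Sum>\<^sub>\<infinity>j. f j x)"
  shows "integrable M (f j)"
    and "((\<lambda>j. LINT x|M. f j x) has_sum (LINT x|M. (\<Sum>\<^sub>\<infinity>j. f j x))) UNIV"
proof -
  have le: "(\<Sum>j\<in>B. f j x) \<le> (\<Sum>\<^sub>\<infinity>j. f j x)" if "finite B" "x \<in> space M" for B x
    using finite_sum_le_infsum[OF pointwise[OF that(2)] that(1)] pos by simp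
  have integrable: "integrable M (f j)" for j
    by (rule Bochner_Integration.integrable_bound[OF int meas])
       (use le[of "{j}"] pos in \<open>auto intro!: AE_I2 order_trans[OF _ abs_ge_self]\<close>)
  then show "integrable M (f j)" .
  have "(\<Sum>j\<in>B. LINT x|M. f j x) \<le> (LINT x|M. (\<Sum>\<^sub>\<infinity>j. f j x))" if "finite B" for B
  proof -
    have "(\<Sum>j\<in>B. LINT x|M. f j x) = (LINT x|M. (\<Sum>j\<in>B. f j x))"
      using integrable by (simp add: Bochner_Integration.integral_sum)
    also have "\<dots> \<le> (LINT x|M. (\<Sum>\<^sub>\<infinity>j. f j x))"
      using integrable int le[OF that] by (intro integral_mono) auto
    finally show ?thesis .
  qed
  then have "(\<lambda>j. LINT x|M. f j x) summable_on UNIV"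
    by (intro nonneg_bounded_partial_sums_imp_summable_on[where C = "LINT x|M. (\<Sum>\<^sub>\<infinity>j. f j x)"]
        eventually_finite_subsets_at_top_weakI) (auto simp: pos)
  then show "((\<lambda>j. LINT x|M. f j x) has_sum (LINT x|M. (\<Sum>\<^sub>\<infinity>j. f j x))) UNIV"
    by (intro integral_infsum_int integrable pos pointwise)
qed

lemma ind_space_simps:
  "F \<in> vecs (ind_space \<xi>) \<longleftrightarrow>
     (\<forall>j b. F (j, b) = \<xi> b * F (j, 0)) \<and> (\<lambda>j. (cmod (F (j, 0)))\<^sup>2) summable_on UNIV"
  "vadd (ind_space \<xi>) F F' = (\<lambda>g. F g + F' g)"
  "vscale (ind_space \<xi>) c F = (\<lambda>g. c * F g)"
  "vinner (ind_space \<xi>) F F' = (\<Sum>\<^sub>\<infinity>j. F (j, 0) * cnj (F' (j, 0)))"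
  by (simp_all add: ind_space_def)

lemma ind_spaceD:
  assumes "F \<in> vecs (ind_space \<xi>)"
  shows "F (j, b) = \<xi> b * F (j, 0)" "(\<lambda>j. (cmod (F (j, 0)))\<^sup>2) summable_on UNIV"
  using assms unfolding ind_space_simps by blast+

lemma ind_spaceI:
  assumes "\<And>j b. F (j, b) = \<xi> b * F (j, 0)" "(\<lambda>j. (cmod (F (j, 0)))\<^sup>2) summable_on UNIV"
  shows "F \<in> vecs (ind_space \<xi>)"
  using assms unfolding ind_space_simps by blast

definition fibre_norm2 :: "(int \<times> 'b::ab_group_add \<Rightarrow> complex) \<Rightarrow> real" where
  "fibre_norm2 F = (\<Sum>\<^sub>\<infinity>j. (cmod (F (j, 0)))\<^sup>2)"

lemma vinner_ind_space_self:
  assumes "F \<in> vecs (ind_space \<xi>)"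
  shows "Re (vinner (ind_space \<xi>) F F) = fibre_norm2 F"
proof -
  have "((\<lambda>j. complex_of_real ((cmod (F (j, 0)))\<^sup>2)) has_sum complex_of_real (fibre_norm2 F)) UNIV"
    unfolding fibre_norm2_def by (intro has_sum_of_real has_sum_infsum ind_spaceD(2)[OF assms])
  then have "((\<lambda>j. F (j, 0) * cnj (F (j, 0))) has_sum complex_of_real (fibre_norm2 F)) UNIV"
    by (simp only: complex_norm_square)
  then show ?thesis by (simp add: ind_space_simps(4) infsumI)
qed

lemma vinner_ind_space_polar:
  assumes F: "F \<in> vecs (ind_space \<xi>)" and F': "F' \<in> vecs (ind_space \<xi>)"
  shows "vinner (ind_space \<xi>) F F' = polar (\<lambda>c. fibre_norm2 (\<lambda>g. F g + c * F' g))"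
proof -
  have "((\<lambda>j. (cmod (F (j, 0) + c * F' (j, 0)))\<^sup>2) has_sum fibre_norm2 (\<lambda>g. F g + c * F' g)) UNIV" for c
    unfolding fibre_norm2_def
    by (intro has_sum_infsum square_summable_add square_summable_cmult ind_spaceD(2)[OF F]
        ind_spaceD(2)[OF F'])
  from has_sum_polar[where N = "\<lambda>j c. (cmod (F (j, 0) + c * F' (j, 0)))\<^sup>2", OF this] show ?thesis
    by (simp add: ind_space_simps(4) infsumI flip: polarization_cnj)
qed

context haar_dual
begin

abbreviation fields :: "(('b \<Rightarrow> complex) \<Rightarrow> int \<times> 'b \<Rightarrow> complex) set" where
  "fields \<equiv> l2_fields \<mu> ind_space"

lemma fields_iff:
  "\<phi> \<in> fields \<longleftrightarrow> (\<forall>\<xi>\<in>dual_group. \<phi> \<xi> \<in> vecs (ind_space \<xi>)) \<and>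
     (\<forall>g. (\<lambda>\<xi>. \<phi> \<xi> g) \<in> borel_measurable \<mu>) \<and> integrable \<mu> (\<lambda>\<xi>. fibre_norm2 (\<phi> \<xi>))"
proof -
  have "integrable \<mu> (\<lambda>\<xi>. Re (vinner (ind_space \<xi>) (\<phi> \<xi>) (\<phi> \<xi>)))
      = integrable \<mu> (\<lambda>\<xi>. fibre_norm2 (\<phi> \<xi>))"
    if "\<forall>\<xi>\<in>dual_group. \<phi> \<xi> \<in> vecs (ind_space \<xi>)"
    using that by (intro Bochner_Integration.integrable_cong refl vinner_ind_space_self)
      (simp add: space_haar)
  then show ?thesis unfolding l2_fields_def space_haar mem_Collect_eq by blast
qed

lemma fieldsD:
  assumes "\<phi> \<in> fields"
  shows "\<xi> \<in> dual_group \<Longrightarrow> \<phi> \<xi> \<in> vecs (ind_space \<xi>)"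
    and "(\<lambda>\<xi>. \<phi> \<xi> g) \<in> borel_measurable \<mu>"
    and "integrable \<mu> (\<lambda>\<xi>. fibre_norm2 (\<phi> \<xi>))"
    and "\<xi> \<in> dual_group \<Longrightarrow> \<phi> \<xi> (j, b) = \<xi> b * \<phi> \<xi> (j, 0)"
    and "\<xi> \<in> dual_group \<Longrightarrow> (\<lambda>j. (cmod (\<phi> \<xi> (j, 0)))\<^sup>2) summable_on UNIV"
proof -
  show vec: "\<phi> \<xi> \<in> vecs (ind_space \<xi>)" if "\<xi> \<in> dual_group" for \<xi>
    using assms that unfolding fields_iff by blast
  show "(\<lambda>\<xi>. \<phi> \<xi> g) \<in> borel_measurable \<mu>" "integrable \<mu> (\<lambda>\<xi>. fibre_norm2 (\<phi> \<xi>))"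
    using assms unfolding fields_iff by blast+
  show "\<phi> \<xi> (j, b) = \<xi> b * \<phi> \<xi> (j, 0)" "(\<lambda>j. (cmod (\<phi> \<xi> (j, 0)))\<^sup>2) summable_on UNIV"
    if "\<xi> \<in> dual_group"
    by (rule ind_spaceD[OF vec[OF that]])+
qed

lemma fields_component_integrals:
  assumes \<phi>: "\<phi> \<in> fields"
  shows "square_integrable \<mu> (\<lambda>\<xi>. \<phi> \<xi> (j, 0))"
    and "((\<lambda>j. LINT \<xi>|\<mu>. (cmod (\<phi> \<xi> (j, 0)))\<^sup>2) has_sum (LINT \<xi>|\<mu>. fibre_norm2 (\<phi> \<xi>))) UNIV"
proof -
  note [measurable] = fieldsD(2)[OF \<phi>]
  note * = integral_infsum_int_of_integrable[where M = \<mu> and f = "\<lambda>j \<xi>. (cmod (\<phi> \<xi> (j, 0)))\<^sup>2"]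
  show "square_integrable \<mu> (\<lambda>\<xi>. \<phi> \<xi> (j, 0))"
    unfolding square_integrable_def
    by (intro conjI *(1)) (use fieldsD(3,5)[OF \<phi>] in \<open>auto simp: space_haar fibre_norm2_def\<close>)
  show "((\<lambda>j. LINT \<xi>|\<mu>. (cmod (\<phi> \<xi> (j, 0)))\<^sup>2) has_sum (LINT \<xi>|\<mu>. fibre_norm2 (\<phi> \<xi>))) UNIV"
    unfolding fibre_norm2_def
    by (intro *(2)) (use fieldsD(3,5)[OF \<phi>] in \<open>auto simp: space_haar fibre_norm2_def\<close>)
qed

lemma fields_square_integrable:
  assumes \<phi>: "\<phi> \<in> fields"
  shows "square_integrable \<mu> (\<lambda>\<xi>. \<phi> \<xi> g)"
proof (cases g)
  case (Pair j b)
  have "square_integrable \<mu> (\<lambda>\<xi>. \<xi> b * \<phi> \<xi> (j, 0))"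
    by (intro square_integrable_mult_continuous continuous_on_evaluation fields_component_integrals \<phi>)
  then have "integrable \<mu> (\<lambda>\<xi>. (cmod (\<phi> \<xi> g))\<^sup>2)"
    unfolding square_integrable_def Pair
    by (subst Bochner_Integration.integrable_cong[OF refl]) (auto simp: space_haar fieldsD(4)[OF \<phi>, of _ j b])
  then show ?thesis using fieldsD(2)[OF \<phi>] by (simp add: square_integrable_def)
qed

lemma fields_integrable:
  assumes \<phi>: "\<phi> \<in> fields"
  shows "integrable \<mu> (\<lambda>\<xi>. \<phi> \<xi> g)"
proof -
  have "integrable \<mu> (\<lambda>\<xi>. \<phi> \<xi> g * cnj 1)"
    by (rule integrable_mult_cnj[OF fields_square_integrable[OF \<phi>]]) (simp add: square_integrable_def)
  then show ?thesis by simp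
qed

lemma fieldsI:
  assumes vec: "\<And>\<xi>. \<xi> \<in> dual_group \<Longrightarrow> \<phi> \<xi> \<in> vecs (ind_space \<xi>)"
    and int: "\<And>j. integrable \<mu> (\<lambda>\<xi>. (cmod (\<phi> \<xi> (j, 0)))\<^sup>2)"
    and meas: "\<And>g. (\<lambda>\<xi>. \<phi> \<xi> g) \<in> borel_measurable \<mu>"
    and sum: "(\<lambda>j. LINT \<xi>|\<mu>. (cmod (\<phi> \<xi> (j, 0)))\<^sup>2) summable_on UNIV"
  shows "\<phi> \<in> fields"
proof -
  have "integrable \<mu> (\<lambda>\<xi>. fibre_norm2 (\<phi> \<xi>))"
    unfolding fibre_norm2_def
    by (intro integral_infsum_int(1) int sum) (auto simp: space_haar intro: ind_spaceD(2)[OF vec])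
  then show ?thesis using vec meas by (simp add: fields_iff)
qed

lemma fields_linear:
  assumes \<phi>: "\<phi> \<in> fields" and \<psi>: "\<psi> \<in> fields"
  shows "(\<lambda>\<xi> g. \<phi> \<xi> g + c * \<psi> \<xi> g) \<in> fields"
proof (rule fieldsI)
  fix \<xi> :: "'b \<Rightarrow> complex" assume \<xi>: "\<xi> \<in> dual_group"
  show "(\<lambda>g. \<phi> \<xi> g + c * \<psi> \<xi> g) \<in> vecs (ind_space \<xi>)"
  proof (rule ind_spaceI)
    show "\<phi> \<xi> (j, b) + c * \<psi> \<xi> (j, b) = \<xi> b * (\<phi> \<xi> (j, 0) + c * \<psi> \<xi> (j, 0))" for j b
      unfolding fieldsD(4)[OF \<phi> \<xi>, of j b] fieldsD(4)[OF \<psi> \<xi>, of j b] by (simp add: algebra_simps)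
    show "(\<lambda>j. (cmod (\<phi> \<xi> (j, 0) + c * \<psi> \<xi> (j, 0)))\<^sup>2) summable_on UNIV"
      by (intro square_summable_add square_summable_cmult fieldsD(5) \<phi> \<psi> \<xi>)
  qed
next
  let ?c = "2 * (cmod c)\<^sup>2"
  have si: "square_integrable \<mu> (\<lambda>\<xi>. \<phi> \<xi> g + c * \<psi> \<xi> g)" for g
    by (intro square_integrable_add square_integrable_cmult fields_square_integrable \<phi> \<psi>)
  then show "integrable \<mu> (\<lambda>\<xi>. (cmod (\<phi> \<xi> (j, 0) + c * \<psi> \<xi> (j, 0)))\<^sup>2)"
    "(\<lambda>\<xi>. \<phi> \<xi> g + c * \<psi> \<xi> g) \<in> borel_measurable \<mu>" for j g
    by (auto simp: square_integrable_def)
  show "(\<lambda>j. LINT \<xi>|\<mu>. (cmod (\<phi> \<xi> (j, 0) + c * \<psi> \<xi> (j, 0)))\<^sup>2) summable_on UNIV"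
  proof (rule summable_on_comparison_test)
    show "(\<lambda>j. 2 * (LINT \<xi>|\<mu>. (cmod (\<phi> \<xi> (j, 0)))\<^sup>2) + ?c * (LINT \<xi>|\<mu>. (cmod (\<psi> \<xi> (j, 0)))\<^sup>2)) summable_on UNIV"
      using fields_component_integrals(2)[OF \<phi>] fields_component_integrals(2)[OF \<psi>]
      by (intro summable_on_add summable_on_cmult_right) (auto simp: summable_on_def)
    fix j
    have int: "integrable \<mu> (\<lambda>\<xi>. 2 * (cmod (\<phi> \<xi> (j, 0)))\<^sup>2)" "integrable \<mu> (\<lambda>\<xi>. ?c * (cmod (\<psi> \<xi> (j, 0)))\<^sup>2)"
      using fields_component_integrals(1)[OF \<phi>, of j] fields_component_integrals(1)[OF \<psi>, of j]
      by (auto simp: square_integrable_def)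
    have "(LINT \<xi>|\<mu>. (cmod (\<phi> \<xi> (j, 0) + c * \<psi> \<xi> (j, 0)))\<^sup>2)
        \<le> (LINT \<xi>|\<mu>. 2 * (cmod (\<phi> \<xi> (j, 0)))\<^sup>2 + ?c * (cmod (\<psi> \<xi> (j, 0)))\<^sup>2)"
    proof (rule integral_mono)
      show "integrable \<mu> (\<lambda>\<xi>. (cmod (\<phi> \<xi> (j, 0) + c * \<psi> \<xi> (j, 0)))\<^sup>2)"
        using si by (auto simp: square_integrable_def)
      show "integrable \<mu> (\<lambda>\<xi>. 2 * (cmod (\<phi> \<xi> (j, 0)))\<^sup>2 + ?c * (cmod (\<psi> \<xi> (j, 0)))\<^sup>2)"
        by (intro Bochner_Integration.integrable_add int)
      show "(cmod (\<phi> \<xi> (j, 0) + c * \<psi> \<xi> (j, 0)))\<^sup>2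
          \<le> 2 * (cmod (\<phi> \<xi> (j, 0)))\<^sup>2 + ?c * (cmod (\<psi> \<xi> (j, 0)))\<^sup>2" for \<xi>
        using cmod_add_square_le[of "\<phi> \<xi> (j, 0)" "c * \<psi> \<xi> (j, 0)"]
        by (simp add: norm_mult power_mult_distrib)
    qed
    also have "\<dots> = 2 * (LINT \<xi>|\<mu>. (cmod (\<phi> \<xi> (j, 0)))\<^sup>2) + ?c * (LINT \<xi>|\<mu>. (cmod (\<psi> \<xi> (j, 0)))\<^sup>2)"
      by (simp only: Bochner_Integration.integral_add[OF int] integral_mult_right_zero)
    finally show "(LINT \<xi>|\<mu>. (cmod (\<phi> \<xi> (j, 0) + c * \<psi> \<xi> (j, 0)))\<^sup>2)
        \<le> 2 * (LINT \<xi>|\<mu>. (cmod (\<phi> \<xi> (j, 0)))\<^sup>2) + ?c * (LINT \<xi>|\<mu>. (cmod (\<psi> \<xi> (j, 0)))\<^sup>2)" .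
  qed simp
qed

section \<open>The Fourier transform of fields\<close>

text \<open>As \<open>\<phi> \<xi> (j, b) = \<xi> b * \<phi> \<xi> (j, 0)\<close>, the integral over \<open>\<xi>\<close> of \<open>\<phi> \<xi> (j, b)\<close> is the \<open>b\<close>-th
  Fourier coefficient of \<open>\<xi> \<mapsto> \<phi> \<xi> (j, 0)\<close>. In this form it visibly commutes with translations of
  the argument in \<open>G\<close>.\<close>

definition transform :: "(('b \<Rightarrow> complex) \<Rightarrow> int \<times> 'b \<Rightarrow> complex) \<Rightarrow> int \<times> 'b \<Rightarrow> complex" where
  "transform \<phi> g = (LINT \<xi>|\<mu>. \<phi> \<xi> g)"

lemma transform_eq_coef:
  assumes "\<phi> \<in> fields"
  shows "transform \<phi> (j, b) = coef (\<lambda>\<xi>. \<phi> \<xi> (j, 0)) b"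
  unfolding transform_def coef_dual_basis
  by (rule Bochner_Integration.integral_cong)
     (auto simp: space_haar fieldsD(4)[OF assms, of _ j b])

lemma transform_linear:
  assumes "\<phi> \<in> fields" "\<psi> \<in> fields"
  shows "transform (\<lambda>\<xi> g. \<phi> \<xi> g + c * \<psi> \<xi> g) = (\<lambda>g. transform \<phi> g + c * transform \<psi> g)"
  using fields_integrable[OF assms(1)] fields_integrable[OF assms(2)]
  by (auto simp: transform_def)

text \<open>Parseval's identity for each \<open>j\<close>, summed over \<open>j\<close>.\<close>

lemma transform_isometric:
  assumes \<phi>: "\<phi> \<in> fields"
  shows "((\<lambda>g. (cmod (transform \<phi> g))\<^sup>2) has_sum (LINT \<xi>|\<mu>. fibre_norm2 (\<phi> \<xi>))) UNIV"
proof -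
  have inner: "((\<lambda>b. (cmod (transform \<phi> (j, b)))\<^sup>2) has_sum (LINT \<xi>|\<mu>. (cmod (\<phi> \<xi> (j, 0)))\<^sup>2)) UNIV" for j
    using Parseval[OF fields_component_integrals(1)[OF \<phi>, of j]]
    by (simp add: transform_eq_coef[OF \<phi>])
  note outer = fields_component_integrals(2)[OF \<phi>]
  have "(\<lambda>g. (cmod (transform \<phi> g))\<^sup>2) summable_on Sigma UNIV (\<lambda>_. UNIV)"
    by (rule summable_on_SigmaI[OF inner]) (use outer in \<open>auto simp: summable_on_def\<close>)
  from has_sum_SigmaI[OF inner outer this] show ?thesis by simp
qed

lemma transform_inner:
  assumes \<phi>: "\<phi> \<in> fields" and \<psi>: "\<psi> \<in> fields"
  shows "(\<Sum>\<^sub>\<infinity>g. transform \<phi> g * cnj (transform \<psi> g))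
    = (LINT \<xi>|\<mu>. vinner (ind_space \<xi>) (\<phi> \<xi>) (\<psi> \<xi>))"
proof -
  have "((\<lambda>g. (cmod (transform \<phi> g + c * transform \<psi> g))\<^sup>2)
      has_sum (LINT \<xi>|\<mu>. fibre_norm2 (\<lambda>g. \<phi> \<xi> g + c * \<psi> \<xi> g))) UNIV" for c
    using transform_isometric[OF fields_linear[OF \<phi> \<psi>, of c]]
    by (simp add: transform_linear[OF \<phi> \<psi>])
  from has_sum_polar[where N = "\<lambda>g c. (cmod (transform \<phi> g + c * transform \<psi> g))\<^sup>2", OF this]
  have "(\<Sum>\<^sub>\<infinity>g. transform \<phi> g * cnj (transform \<psi> g))
      = polar (\<lambda>c. LINT \<xi>|\<mu>. fibre_norm2 (\<lambda>g. \<phi> \<xi> g + c * \<psi> \<xi> g))"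
    by (simp add: infsumI flip: polarization_cnj)
  also have "\<dots> = (LINT \<xi>|\<mu>. polar (\<lambda>c. fibre_norm2 (\<lambda>g. \<phi> \<xi> g + c * \<psi> \<xi> g)))"
    by (rule integral_polar[symmetric]) (rule fieldsD(3)[OF fields_linear[OF \<phi> \<psi>]])
  also have "\<dots> = (LINT \<xi>|\<mu>. vinner (ind_space \<xi>) (\<phi> \<xi>) (\<psi> \<xi>))"
    by (rule Bochner_Integration.integral_cong)
       (auto simp: space_haar vinner_ind_space_polar fieldsD(1)[OF \<phi>] fieldsD(1)[OF \<psi>])
  finally show ?thesis .
qed

lemma transform_eq_iff:
  assumes \<phi>: "\<phi> \<in> fields" and \<psi>: "\<psi> \<in> fields"
  shows "transform \<phi> = transform \<psi> \<longleftrightarrow> (AE \<xi> in \<mu>. \<phi> \<xi> = \<psi> \<xi>)"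
proof
  assume eq: "transform \<phi> = transform \<psi>"
  have "AE \<xi> in \<mu>. \<phi> \<xi> (j, 0) - \<psi> \<xi> (j, 0) = 0" for j
  proof (rule total)
    have si: "square_integrable \<mu> (\<lambda>\<xi>. \<phi> \<xi> (j, 0))" "square_integrable \<mu> (\<lambda>\<xi>. \<psi> \<xi> (j, 0))"
      by (intro fields_component_integrals \<phi> \<psi>)+
    then show "square_integrable \<mu> (\<lambda>\<xi>. \<phi> \<xi> (j, 0) - \<psi> \<xi> (j, 0))" by auto
    show "coef (\<lambda>\<xi>. \<phi> \<xi> (j, 0) - \<psi> \<xi> (j, 0)) b = 0" for b
      using fun_cong[OF eq, of "(j, b)"]
      by (simp add: coef_diff[OF si] transform_eq_coef[OF \<phi>]
          transform_eq_coef[OF \<psi>])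
  qed
  then have "AE \<xi> in \<mu>. \<forall>j. \<phi> \<xi> (j, 0) - \<psi> \<xi> (j, 0) = 0" by (simp add: AE_all_countable)
  with AE_space show "AE \<xi> in \<mu>. \<phi> \<xi> = \<psi> \<xi>"
  proof eventually_elim
    case (elim \<xi>)
    then have \<xi>: "\<xi> \<in> dual_group" by (simp add: space_haar)
    have "\<phi> \<xi> (j, b) = \<psi> \<xi> (j, b)" for j b
      unfolding fieldsD(4)[OF \<phi> \<xi>, of j b] fieldsD(4)[OF \<psi> \<xi>, of j b] using elim by simp
    then show ?case by auto
  qed
next
  assume "AE \<xi> in \<mu>. \<phi> \<xi> = \<psi> \<xi>"
  then show "transform \<phi> = transform \<psi>"
    using fieldsD(2)[OF \<phi>] fieldsD(2)[OF \<psi>]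
    by (auto simp: transform_def fun_eq_iff intro!: integral_cong_AE)
qed

text \<open>Riesz--Fischer supplies the components \<open>f j\<close> separately. Their values are square summable over
  \<open>j\<close> only almost everywhere, so the field is set to zero on a null set \<open>N\<close> to lie in every fibre.\<close>

lemma transform_surj:
  assumes F: "(\<lambda>g. (cmod (F g))\<^sup>2) summable_on UNIV"
  obtains \<phi> where "\<phi> \<in> fields" "transform \<phi> = F"
proof -
  have F': "(\<lambda>(j, b). (cmod (F (j, b)))\<^sup>2) summable_on Sigma UNIV (\<lambda>_. UNIV)"
    using F by (simp add: case_prod_unfold)
  have "\<exists>f. square_integrable \<mu> f \<and> (\<forall>b. coef f b = F (j, b)) \<and>
      ((\<lambda>b. (cmod (F (j, b)))\<^sup>2) has_sum (LINT \<xi>|\<mu>. (cmod (f \<xi>))\<^sup>2)) UNIV" for j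
    using Riesz_Fischer[OF summable_on_SigmaD1[OF F' UNIV_I], of j] by blast
  then obtain f where f: "\<And>j. square_integrable \<mu> (f j)" "\<And>j b. coef (f j) b = F (j, b)"
      "\<And>j. ((\<lambda>b. (cmod (F (j, b)))\<^sup>2) has_sum (LINT \<xi>|\<mu>. (cmod (f j \<xi>))\<^sup>2)) UNIV"
    by metis
  note [measurable] = square_integrableD(1)[OF f(1)]
  have sum: "(\<lambda>j. LINT \<xi>|\<mu>. (cmod (f j \<xi>))\<^sup>2) summable_on UNIV"
    using has_sum_SigmaD[OF has_sum_infsum[OF F'], of "\<lambda>j. LINT \<xi>|\<mu>. (cmod (f j \<xi>))\<^sup>2"] f(3)
    by (auto simp: summable_on_def)
  then have "summable (\<lambda>n. LINT \<xi>|\<mu>. (cmod (f (int_decode n) \<xi>))\<^sup>2)"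
    using summable_on_reindex_bij_betw[OF bij_int_decode, of "\<lambda>j. LINT \<xi>|\<mu>. (cmod (f j \<xi>))\<^sup>2"]
    by (simp add: summable_on_UNIV_nonneg_real_iff)
  then have "AE \<xi> in \<mu>. summable (\<lambda>n. (cmod (f (int_decode n) \<xi>))\<^sup>2)"
    using f(1) by (intro AE_summable_of_summable_integrals) (auto simp: square_integrable_def)
  then have "AE \<xi> in \<mu>. (\<lambda>j. (cmod (f j \<xi>))\<^sup>2) summable_on UNIV"
  proof eventually_elim
    case (elim \<xi>)
    then show ?case
      using summable_on_reindex_bij_betw[OF bij_int_decode, of "\<lambda>j. (cmod (f j \<xi>))\<^sup>2"]
      by (simp add: summable_on_UNIV_nonneg_real_iff)
  qed
  then obtain N where N: "N \<in> null_sets \<mu>"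
      "{\<xi> \<in> space \<mu>. \<not> (\<lambda>j. (cmod (f j \<xi>))\<^sup>2) summable_on UNIV} \<subseteq> N"
    by (auto simp: eventually_ae_filter)
  then have [measurable]: "N \<in> sets \<mu>" by auto
  define \<phi> where "\<phi> \<xi> = (\<lambda>(j, b). if \<xi> \<in> N then 0 else \<xi> b * f j \<xi>)" for \<xi> :: "'b \<Rightarrow> complex"
  have \<phi>0: "\<phi> \<xi> (j, 0) = (if \<xi> \<in> N then 0 else f j \<xi>)" if "\<xi> \<in> dual_group" for \<xi> j
    by (simp add: \<phi>_def dual_groupD(3)[OF that])
  have \<phi>b: "\<phi> \<xi> (j, b) = \<xi> b * \<phi> \<xi> (j, 0)" if "\<xi> \<in> dual_group" for \<xi> j b
    by (simp add: \<phi>_def dual_groupD(3)[OF that])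
  have meas [measurable]: "(\<lambda>\<xi>. \<phi> \<xi> g) \<in> borel_measurable \<mu>" for g
    by (cases g) (simp add: \<phi>_def)
  have ae: "AE \<xi> in \<mu>. \<phi> \<xi> (j, 0) = f j \<xi>" for j
    using AE_not_in[OF N(1)] AE_space by eventually_elim (simp add: \<phi>0 space_haar)
  have norm: "AE \<xi> in \<mu>. (cmod (\<phi> \<xi> (j, 0)))\<^sup>2 = (cmod (f j \<xi>))\<^sup>2" for j
    using ae[of j] by eventually_elim simp
  have int: "(LINT \<xi>|\<mu>. (cmod (\<phi> \<xi> (j, 0)))\<^sup>2) = (LINT \<xi>|\<mu>. (cmod (f j \<xi>))\<^sup>2)" for j
    by (intro integral_cong_AE norm) measurable
  have fields: "\<phi> \<in> fields"
  proof (rule fieldsI)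
    fix \<xi> :: "'b \<Rightarrow> complex" assume \<xi>: "\<xi> \<in> dual_group"
    then have "(\<lambda>j. (cmod (\<phi> \<xi> (j, 0)))\<^sup>2) summable_on UNIV"
      using N(2) by (cases "\<xi> \<in> N") (auto simp: \<phi>0 space_haar)
    then show "\<phi> \<xi> \<in> vecs (ind_space \<xi>)"
      by (intro ind_spaceI \<phi>b \<xi>)
  next
    show "integrable \<mu> (\<lambda>\<xi>. (cmod (\<phi> \<xi> (j, 0)))\<^sup>2)" for j
      by (subst integrable_cong_AE[OF _ _ norm]) (use square_integrableD[OF f(1)] in auto)
  qed (use sum int meas in simp_all)
  have "transform \<phi> (j, b) = F (j, b)" for j b
  proof -
    have "transform \<phi> (j, b) = coef (\<lambda>\<xi>. \<phi> \<xi> (j, 0)) b"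
      by (rule transform_eq_coef[OF fields])
    also have "\<dots> = coef (f j) b"
      unfolding coef_dual_basis
      by (rule integral_cong_AE) (use ae[of j] in \<open>auto elim: eventually_mono\<close>)
    finally show ?thesis by (simp add: f(2))
  qed
  then have "transform \<phi> = F" by auto
  with fields show ?thesis by (rule that)
qed

end

section \<open>The unitary equivalence\<close>

context haar_dual
begin

text \<open>A vector of the direct integral is a class of fields. The class of fields with transform \<open>F\<close> is
  a canonical preimage of \<open>F\<close>, hence no representatives have to be chosen.\<close>

definition inverse_transform ::
    "(int \<times> 'b \<Rightarrow> complex) \<Rightarrow> (('b \<Rightarrow> complex) \<Rightarrow> int \<times> 'b \<Rightarrow> complex) set" where
  "inverse_transform F = {\<phi> \<in> fields. transform \<phi> = F}"

lemma inverse_transform_fields: "\<phi> \<in> inverse_transform F \<Longrightarrow> \<phi> \<in> fields"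
  by (simp add: inverse_transform_def)

lemma inverse_transform_nonempty:
  assumes "F \<in> vecs l2_space"
  obtains \<phi> where "\<phi> \<in> inverse_transform F"
  using transform_surj[of F] assms unfolding inverse_transform_def l2_space_simps mem_Collect_eq
  by metis

lemma transform_in_l2:
  assumes "\<phi> \<in> fields"
  shows "transform \<phi> \<in> vecs l2_space"
  using transform_isometric[OF assms] by (auto simp: summable_on_def)

lemma AE_eq_iff_inverse_transform:
  assumes "\<phi> \<in> fields" "transform \<phi> = F" "\<rho> \<in> fields"
  shows "(AE \<xi> in \<mu>. \<rho> \<xi> = \<phi> \<xi>) \<longleftrightarrow> \<rho> \<in> inverse_transform F"
  using transform_eq_iff[OF assms(3,1)] assms(2,3) by (simp add: inverse_transform_def)

lemma field_class_eq:
  assumes "\<phi> \<in> fields"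
  shows "field_eq \<mu> ind_space `` {\<phi>} = inverse_transform (transform \<phi>)"
proof -
  have "(AE \<xi> in \<mu>. \<phi> \<xi> = \<psi> \<xi>) \<longleftrightarrow> transform \<psi> = transform \<phi>" if "\<psi> \<in> fields" for \<psi>
    using transform_eq_iff[OF assms that] by auto
  then show ?thesis
    using assms by (auto simp: field_eq_def inverse_transform_def)
qed

lemma bij_betw_inverse_transform:
  "bij_betw inverse_transform (vecs l2_space) (vecs (direct_integral \<mu> ind_space))"
proof (rule bij_betw_imageI)
  show "inj_on inverse_transform (vecs l2_space)"
  proof (rule inj_onI)
    fix F F' :: "int \<times> 'b \<Rightarrow> complex" assume "F \<in> vecs l2_space" and eq: "inverse_transform F = inverse_transform F'"
    then obtain \<phi> where "\<phi> \<in> inverse_transform F" by (elim inverse_transform_nonempty)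
    with eq show "F = F'" by (auto simp: inverse_transform_def)
  qed
  have "vecs (direct_integral \<mu> ind_space) = (\<lambda>\<phi>. inverse_transform (transform \<phi>)) ` fields"
    by (auto simp: direct_integral_def quotient_def field_class_eq)
  moreover have "transform ` fields = vecs l2_space"
  proof (intro equalityI subsetI)
    fix F :: "int \<times> 'b \<Rightarrow> complex" assume "F \<in> vecs l2_space"
    then obtain \<phi> where "\<phi> \<in> inverse_transform F" by (rule inverse_transform_nonempty)
    then show "F \<in> transform ` fields" by (auto simp: inverse_transform_def)
  qed (use transform_in_l2 in blast)
  ultimately show "inverse_transform ` vecs l2_space = vecs (direct_integral \<mu> ind_space)"
    by (metis image_image)
qed

lemma inverse_transform_add:
  assumes F: "F \<in> vecs l2_space" and F': "F' \<in> vecs l2_space"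
  shows "vadd (direct_integral \<mu> ind_space) (inverse_transform F) (inverse_transform F')
    = inverse_transform (vadd l2_space F F')"
proof -
  have iff: "(AE \<xi> in \<mu>. \<rho> \<xi> = vadd (ind_space \<xi>) (\<phi> \<xi>) (\<psi> \<xi>)) \<longleftrightarrow> \<rho> \<in> inverse_transform (vadd l2_space F F')"
    if "\<phi> \<in> inverse_transform F" "\<psi> \<in> inverse_transform F'" "\<rho> \<in> fields" for \<phi> \<psi> \<rho>
  proof -
    have mem: "\<phi> \<in> fields" "\<psi> \<in> fields" and eq: "transform \<phi> = F" "transform \<psi> = F'"
      using that by (auto simp: inverse_transform_def)
    show ?thesis
      using AE_eq_iff_inverse_transform[OF fields_linear[OF mem, of 1] transform_linear[OF mem] that(3)] eq
      by (simp add: ind_space_simps(2))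
  qed
  obtain \<phi> \<psi> where "\<phi> \<in> inverse_transform F" "\<psi> \<in> inverse_transform F'"
    using inverse_transform_nonempty[OF F] inverse_transform_nonempty[OF F'] by metis
  then show ?thesis
    unfolding direct_integral_def cinner_space.simps
    using iff inverse_transform_fields by blast
qed

lemma inverse_transform_scale:
  assumes F: "F \<in> vecs l2_space"
  shows "vscale (direct_integral \<mu> ind_space) c (inverse_transform F)
    = inverse_transform (vscale l2_space c F)"
proof -
  have iff: "(AE \<xi> in \<mu>. \<rho> \<xi> = vscale (ind_space \<xi>) c (\<phi> \<xi>)) \<longleftrightarrow> \<rho> \<in> inverse_transform (vscale l2_space c F)"
    if "\<phi> \<in> inverse_transform F" "\<rho> \<in> fields" for \<phi> \<rho>
  proof -
    have mem: "\<phi> \<in> fields" and eq: "transform \<phi> = F"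
      using that by (auto simp: inverse_transform_def)
    \<comment> \<open>\<open>c \<phi> = \<phi> + (c - 1) \<phi>\<close> reduces scaling to the linear combinations covered already.\<close>
    have "(\<lambda>\<xi> g. c * \<phi> \<xi> g) \<in> fields" "transform (\<lambda>\<xi> g. c * \<phi> \<xi> g) = (\<lambda>g. c * F g)"
      using fields_linear[OF mem mem, of "c - 1"] transform_linear[OF mem mem, of "c - 1"] eq
      by (simp_all add: algebra_simps)
    then show ?thesis
      using AE_eq_iff_inverse_transform[OF _ _ that(2)] by (simp add: ind_space_simps(3))
  qed
  obtain \<phi> where "\<phi> \<in> inverse_transform F"
    using inverse_transform_nonempty[OF F] by metis
  then show ?thesis
    unfolding direct_integral_def cinner_space.simps
    using iff inverse_transform_fields by blast
qed

lemma inverse_transform_inner: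
  assumes F: "F \<in> vecs l2_space" and F': "F' \<in> vecs l2_space"
  shows "vinner (direct_integral \<mu> ind_space) (inverse_transform F) (inverse_transform F')
    = vinner l2_space F F'"
proof -
  have eq: "(LINT \<xi>|\<mu>. vinner (ind_space \<xi>) (\<phi> \<xi>) (\<psi> \<xi>)) = vinner l2_space F F'"
    if "\<phi> \<in> inverse_transform F" "\<psi> \<in> inverse_transform F'" for \<phi> \<psi>
    using transform_inner[of \<phi> \<psi>] that by (simp add: inverse_transform_def)
  obtain \<phi> \<psi> where "\<phi> \<in> inverse_transform F" "\<psi> \<in> inverse_transform F'"
    using inverse_transform_nonempty[OF F] inverse_transform_nonempty[OF F'] by metis
  then show ?thesis
    unfolding direct_integral_def cinner_space.simps
    by (intro the_equality) (auto simp: eq)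
qed

lemma unitary_inverse_transform:
  "unitary_map l2_space (direct_integral \<mu> ind_space) inverse_transform"
  unfolding unitary_map_def
  using bij_betw_inverse_transform inverse_transform_add inverse_transform_scale
    inverse_transform_inner by simp

text \<open>On the fibre over \<open>\<xi>\<close>, translation by \<open>(k, c)\<close> moves the value at \<open>(j + k, 0)\<close> to \<open>(j, 0)\<close> and
  multiplies it by \<open>\<xi> (\<alpha>\<^sup>j c)\<close>, a number of modulus one, so the fibre norm is unchanged.\<close>

lemma ind_rep_field:
  assumes \<phi>: "\<phi> \<in> fields"
  shows "(\<lambda>\<xi>. ind_rep \<alpha> \<xi> h (\<phi> \<xi>)) \<in> fields"
proof -
  obtain k c where h: "h = (k, c)" by (cases h)
  have ind: "ind_rep \<alpha> \<xi> h F (j, b) = F (j + k, aut_pow \<alpha> j c + b)" for \<xi> F j b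
    by (simp add: ind_rep_def semidirect_def h)
  have shift: "bij (\<lambda>j. j + k)" 
    by (rule bij_betw_byWitness[where f' = "\<lambda>j. j - k"]) auto
  have val: "ind_rep \<alpha> \<xi> h (\<phi> \<xi>) (j, b) = \<xi> b * (\<xi> (aut_pow \<alpha> j c) * \<phi> \<xi> (j + k, 0))"
    if \<xi>: "\<xi> \<in> dual_group" for \<xi> j b
    unfolding ind fieldsD(4)[OF \<phi> \<xi>, of "j + k" "aut_pow \<alpha> j c + b"] by (simp add: dual_groupD(2)[OF \<xi>])
  have norm: "(cmod (ind_rep \<alpha> \<xi> h (\<phi> \<xi>) (j, 0)))\<^sup>2 = (cmod (\<phi> \<xi> (j + k, 0)))\<^sup>2"
    if \<xi>: "\<xi> \<in> dual_group" for \<xi> j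
    by (simp add: val[OF \<xi>] norm_mult dual_groupD(1,3)[OF \<xi>])
  have "ind_rep \<alpha> \<xi> h (\<phi> \<xi>) \<in> vecs (ind_space \<xi>)" if \<xi>: "\<xi> \<in> dual_group" for \<xi>
  proof (rule ind_spaceI)
    show "ind_rep \<alpha> \<xi> h (\<phi> \<xi>) (j, b) = \<xi> b * ind_rep \<alpha> \<xi> h (\<phi> \<xi>) (j, 0)" for j b
      by (simp add: val[OF \<xi>] dual_groupD(3)[OF \<xi>])
    show "(\<lambda>j. (cmod (ind_rep \<alpha> \<xi> h (\<phi> \<xi>) (j, 0)))\<^sup>2) summable_on UNIV"
      unfolding norm[OF \<xi>]
      using fieldsD(5)[OF \<phi> \<xi>] by (rule summable_on_reindex_bij_betw[OF shift, THEN iffD2])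
  qed
  moreover have "fibre_norm2 (ind_rep \<alpha> \<xi> h (\<phi> \<xi>)) = fibre_norm2 (\<phi> \<xi>)" if \<xi>: "\<xi> \<in> dual_group" for \<xi>
    unfolding fibre_norm2_def norm[OF \<xi>] by (rule infsum_reindex_bij_betw[OF shift])
  then have "integrable \<mu> (\<lambda>\<xi>. fibre_norm2 (ind_rep \<alpha> \<xi> h (\<phi> \<xi>)))"
    using fieldsD(3)[OF \<phi>]
    by (subst Bochner_Integration.integrable_cong[OF refl]) (simp_all add: space_haar)
  moreover have "(\<lambda>\<xi>. ind_rep \<alpha> \<xi> h (\<phi> \<xi>) g) \<in> borel_measurable \<mu>" for g
    unfolding ind_rep_def by (rule fieldsD(2)[OF \<phi>])
  ultimately show ?thesis by (simp add: fields_iff)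
qed

lemma transform_ind_rep:
  "transform (\<lambda>\<xi>. ind_rep \<alpha> \<xi> h (\<phi> \<xi>)) = right_regular (semidirect \<alpha>) h (transform \<phi>)"
  by (rule ext) (simp add: transform_def ind_rep_def right_regular_def)

lemma inverse_transform_intertwines:
  assumes F: "F \<in> vecs l2_space"
  shows "inverse_transform (right_regular (semidirect \<alpha>) h F)
    = direct_integral_rep \<mu> ind_space (ind_rep \<alpha>) h (inverse_transform F)"
proof -
  let ?RF = "right_regular (semidirect \<alpha>) h F"
  have iff: "(AE \<xi> in \<mu>. \<rho> \<xi> = ind_rep \<alpha> \<xi> h (\<phi> \<xi>)) \<longleftrightarrow> \<rho> \<in> inverse_transform ?RF"
    if "\<phi> \<in> inverse_transform F" "\<rho> \<in> fields" for \<phi> \<rho>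
    using that ind_rep_field transform_ind_rep
    by (intro AE_eq_iff_inverse_transform) (auto simp: inverse_transform_def)
  obtain \<phi> where "\<phi> \<in> inverse_transform F"
    using inverse_transform_nonempty[OF F] by metis
  then show ?thesis
    unfolding direct_integral_rep_def using iff inverse_transform_fields by blast
qed

end

theorem theorem6p3:
  fixes \<alpha> :: "'b::ab_group_add \<Rightarrow> 'b"
    and \<mu> :: "('b \<Rightarrow> complex) measure"
  assumes "bij \<alpha>" and "\<And>a b. \<alpha> (a + b) = \<alpha> a + \<alpha> b"
    and "normalized_haar \<mu>"
  shows "unitarily_equivalent (semidirect \<alpha>)
           l2_space (right_regular (semidirect \<alpha>))
           (direct_integral \<mu> ind_space) (direct_integral_rep \<mu> ind_space (ind_rep \<alpha>))"
proof -
  interpret haar_dual \<mu> by standard (rule assms(3))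
  have "unitary_rep (semidirect \<alpha>) l2_space (right_regular (semidirect \<alpha>))"
    by (rule unitary_rep_right_regular[OF group_semidirect[OF assms(1,2)]]) (simp add: semidirect_def)
  then show ?thesis
  proof (rule unitarily_equivalent_transport[OF _ unitary_inverse_transform])
    show "vadd l2_space F F' \<in> vecs l2_space"
      if "F \<in> vecs l2_space" "F' \<in> vecs l2_space" for F F' :: "int \<times> 'b \<Rightarrow> complex"
      using that by (simp add: square_summable_add)
    show "vscale l2_space c F \<in> vecs l2_space"
      if "F \<in> vecs l2_space" for c and F :: "int \<times> 'b \<Rightarrow> complex"
      using that unfolding l2_space_simps by (rule square_summable_cmult)
  qed (rule inverse_transform_intertwines)
qed

end
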